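(* Let $K$ be a field of characteristic zero, let $A=K[x_{i,j},y_{i,j}\,(1\le i<j\le 4),\ z_{i,j,k}\,(1\le i<j<k\le 4)]$, and let $J=\langle u_{2,3,4},u_{1,3,4},u_{1,2,4},u_{1,2,3},u\rangle\subset A$ be the ideal defined in the context. Then all structure constants of the multiplications $F_1\otimes F_1\to F_2$ and $F_1\otimes F_2\to F_3$ on the minimal graded free resolution $0\to F_3\to F_2\to F_1\to F_0=A$ of $A/J$ have positive degree; that is, the multiplication on the Tor algebra is trivial: in $T_\bullet=\operatorname{Tor}^A_\bullet(A/J,K)$ one has $T_1\cdot T_1=0$ and $T_1\cdot T_2=0$.
   Context: All variables of $A$ have degree $1$, and $K=A/(x_{i,j},y_{i,j},z_{i,j,k})$. The multiplication on $F_\bullet$ is a graded (degree-preserving), graded-commutative multiplication making $F_\bullet$ a differential graded algebra resolving $A/J$; its structure constants are the entries, with respect to homogeneous bases, of the maps $F_i\otimes F_j\to F_{i+j}$. It induces the standard algebra structure on $\operatorname{Tor}^A_\bullet(A/J,K)=F_\bullet\otimes_A K$. The group $GL_4(K)\times GL_2(K)$ acts on $A=\operatorname{Sym}(\bigwedge^2F\otimes G\oplus\bigwedge^3F)$ (with $\dim F=4$, $\dim G=2$) preserving $J$, and the multiplication may be taken equivariant. Let $\Delta(ij,kl)=x_{i,j}y_{k,l}-x_{k,l}y_{i,j}$, and $\delta_1=\Delta(12,34)$, $\delta_2=\Delta(13,24)$, $\delta_3=\Delta(14,23)$. Put \begin{align*} u_{1,2,3}&=-2z_{2,3,4}\Delta(12,13)+2z_{1,3,4}\Delta(12,23)-2z_{1,2,4}\Delta(13,23)+z_{1,2,3}(\delta_2-\delta_1+\delta_3),\\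 u_{1,2,4}&=2z_{2,3,4}\Delta(12,14)-2z_{1,3,4}\Delta(12,24)+z_{1,2,4}(\delta_1+\delta_2+\delta_3)-2z_{1,2,3}\Delta(14,24),\\ u_{1,3,4}&=2z_{2,3,4}\Delta(13,14)+z_{1,3,4}(-\delta_1-\delta_2+\delta_3)+2z_{1,2,4}\Delta(13,34)-2z_{1,2,3}\Delta(14,34),\\ u_{2,3,4}&=z_{2,3,4}(-\delta_1+\delta_2-\delta_3)-2z_{1,3,4}\Delta(23,24)+2z_{1,2,4}\Delta(23,34)-2z_{1,2,3}\Delta(24,34), \end{align*} \begin{align*} a&=x_{1,2}x_{3,4}-x_{1,3}x_{2,4}+x_{1,4}x_{2,3},\\ b&=x_{1,2}y_{3,4}-x_{1,3}y_{2,4}+x_{1,4}y_{2,3}+x_{3,4}y_{1,2}-x_{2,4}y_{1,3}+x_{2,3}y_{1,4},\\ c&=y_{1,2}y_{3,4}-y_{1,3}y_{2,4}+y_{1,4}y_{2,3}, \end{align*} and $u=b^2-4ac$. *)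

theory Defs
  imports Complex_Main "HOL-Library.Poly_Mapping"
begin

section \<open>The polynomial ring and the ideal\<close>

datatype pair4 = P12 | P13 | P14 | P23 | P24 | P34
datatype triple4 = T123 | T124 | T134 | T234
datatype var = VX pair4 | VY pair4 | VZ triple4

text \<open>A polynomial is a finitely supported function from monomials (exponent vectors) to
  coefficients; its ring structure is the convolution product of \<^theory>\<open>HOL-Library.Poly_Mapping\<close>.\<close>

type_synonym mono = "var \<Rightarrow>\<^sub>0 nat"
type_synonym 'k polyA = "mono \<Rightarrow>\<^sub>0 'k"

definition var :: "var \<Rightarrow> 'k::comm_ring_1 polyA" where
  "var v = Poly_Mapping.single (Poly_Mapping.single v 1) 1"

abbreviation vx :: "pair4 \<Rightarrow> 'k::comm_ring_1 polyA" where "vx p \<equiv> var (VX p)"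
abbreviation vy :: "pair4 \<Rightarrow> 'k::comm_ring_1 polyA" where "vy p \<equiv> var (VY p)"
abbreviation vz :: "triple4 \<Rightarrow> 'k::comm_ring_1 polyA" where "vz t \<equiv> var (VZ t)"

definition Delta :: "pair4 \<Rightarrow> pair4 \<Rightarrow> 'k::comm_ring_1 polyA" where
  "Delta p q = vx p * vy q - vx q * vy p"

definition delta1 :: "'k::comm_ring_1 polyA" where "delta1 = Delta P12 P34"
definition delta2 :: "'k::comm_ring_1 polyA" where "delta2 = Delta P13 P24"
definition delta3 :: "'k::comm_ring_1 polyA" where "delta3 = Delta P14 P23"

definition u123 :: "'k::comm_ring_1 polyA" where
  "u123 = - 2 * vz T234 * Delta P12 P13 + 2 * vz T134 * Delta P12 P23
          - 2 * vz T124 * Delta P13 P23 + vz T123 * (delta2 - delta1 + delta3)"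

definition u124 :: "'k::comm_ring_1 polyA" where
  "u124 = 2 * vz T234 * Delta P12 P14 - 2 * vz T134 * Delta P12 P24
          + vz T124 * (delta1 + delta2 + delta3) - 2 * vz T123 * Delta P14 P24"

definition u134 :: "'k::comm_ring_1 polyA" where
  "u134 = 2 * vz T234 * Delta P13 P14 + vz T134 * (- delta1 - delta2 + delta3)
          + 2 * vz T124 * Delta P13 P34 - 2 * vz T123 * Delta P14 P34"

definition u234 :: "'k::comm_ring_1 polyA" where
  "u234 = vz T234 * (- delta1 + delta2 - delta3) - 2 * vz T134 * Delta P23 P24
          + 2 * vz T124 * Delta P23 P34 - 2 * vz T123 * Delta P24 P34"

definition pf_a :: "'k::comm_ring_1 polyA" where
  "pf_a = vx P12 * vx P34 - vx P13 * vx P24 + vx P14 * vx P23"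

definition pf_b :: "'k::comm_ring_1 polyA" where
  "pf_b = vx P12 * vy P34 - vx P13 * vy P24 + vx P14 * vy P23
          + vx P34 * vy P12 - vx P24 * vy P13 + vx P23 * vy P14"

definition pf_c :: "'k::comm_ring_1 polyA" where
  "pf_c = vy P12 * vy P34 - vy P13 * vy P24 + vy P14 * vy P23"

definition u_disc :: "'k::comm_ring_1 polyA" where
  "u_disc = pf_b ^ 2 - 4 * pf_a * pf_c"

definition ideal_gen :: "'a::comm_ring_1 set \<Rightarrow> 'a set" where
  "ideal_gen S = module.span (*) S"

definition ideal_J :: "'k::comm_ring_1 polyA set" where
  "ideal_J = ideal_gen {u234, u134, u124, u123, u_disc}"

definition irrelevant_ideal :: "'k::comm_ring_1 polyA set" where
  "irrelevant_ideal = ideal_gen (range var)"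

text \<open>The quotient map from \<open>A\<close> to \<open>K\<close>, where \<open>K\<close> is \<open>A\<close> modulo the irrelevant ideal
  (see \<open>const_coeff_ring_hom\<close> and \<open>kernel_const_coeff\<close> below).\<close>

definition const_coeff :: "'k::comm_ring_1 polyA \<Rightarrow> 'k" where
  "const_coeff p = Poly_Mapping.lookup p 0"

definition mdeg :: "mono \<Rightarrow> nat" where
  "mdeg m = (\<Sum>v\<in>Poly_Mapping.keys m. Poly_Mapping.lookup m v)"

text \<open>As usual, the zero polynomial is homogeneous of every degree, and it is the only
  homogeneous polynomial of a negative degree.\<close>

definition homogeneous :: "int \<Rightarrow> 'k::comm_ring_1 polyA \<Rightarrow> bool" where
  "homogeneous n p \<longleftrightarrow> (\<forall>m\<in>Poly_Mapping.keys p. int (mdeg m) = n)"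

definition positive_degree :: "'k::comm_ring_1 polyA \<Rightarrow> bool" where
  "positive_degree p \<longleftrightarrow> (\<forall>m\<in>Poly_Mapping.keys p. mdeg m > 0)"


section \<open>Complexes of based free modules with a multiplication\<close>

text \<open>The module in homological degree \<open>i\<close> is free with standard basis indexed by
  \<open>j < rk i\<close>, the \<open>j\<close>-th basis element having internal degree \<open>gdeg i j\<close>, so that over \<open>A\<close>
  it is the direct sum of the twists \<open>A(- gdeg i j)\<close>.
  Entry \<open>dmat i j k\<close> is the coefficient of basis element \<open>j\<close> of degree \<open>i - 1\<close> in the differential
  of basis element \<open>k\<close> of degree \<open>i\<close>.  The structure constant \<open>sc p q i j k\<close> is the coefficient of
  basis element \<open>k\<close> of degree \<open>p + q\<close> in the product of the basis elements \<open>i\<close> of degree \<open>p\<close>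
  and \<open>j\<close> of degree \<open>q\<close>.  Only values at indices below the ranks matter.\<close>

record 'a dgfree =
  rk :: "nat \<Rightarrow> nat"
  gdeg :: "nat \<Rightarrow> nat \<Rightarrow> int"
  dmat :: "nat \<Rightarrow> nat \<Rightarrow> nat \<Rightarrow> 'a"
  sc :: "nat \<Rightarrow> nat \<Rightarrow> nat \<Rightarrow> nat \<Rightarrow> nat \<Rightarrow> 'a"

definition fmod :: "'a::comm_ring_1 dgfree \<Rightarrow> nat \<Rightarrow> (nat \<Rightarrow> 'a) set" where
  "fmod F i = {v. \<forall>k\<ge>rk F i. v k = 0}"

definition zerov :: "nat \<Rightarrow> 'a::comm_ring_1" where
  "zerov = (\<lambda>_. 0)"

definition ddiff :: "'a::comm_ring_1 dgfree \<Rightarrow> nat \<Rightarrow> (nat \<Rightarrow> 'a) \<Rightarrow> (nat \<Rightarrow> 'a)" where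
  "ddiff F i v = (\<lambda>j. if 0 < i \<and> j < rk F (i - 1) then \<Sum>k<rk F i. dmat F i j k * v k else 0)"

definition dmult ::
  "'a::comm_ring_1 dgfree \<Rightarrow> nat \<Rightarrow> nat \<Rightarrow> (nat \<Rightarrow> 'a) \<Rightarrow> (nat \<Rightarrow> 'a) \<Rightarrow> (nat \<Rightarrow> 'a)" where
  "dmult F p q v w = (\<lambda>k. if k < rk F (p + q)
     then \<Sum>i<rk F p. \<Sum>j<rk F q. sc F p q i j k * v i * w j else 0)"

definition unitv :: "nat \<Rightarrow> 'a::comm_ring_1" where
  "unitv = (\<lambda>k. if k = 0 then 1 else 0)"

definition cycles :: "'a::comm_ring_1 dgfree \<Rightarrow> nat \<Rightarrow> (nat \<Rightarrow> 'a) set" where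
  "cycles F i = {v \<in> fmod F i. ddiff F i v = zerov}"

definition boundaries :: "'a::comm_ring_1 dgfree \<Rightarrow> nat \<Rightarrow> (nat \<Rightarrow> 'a) set" where
  "boundaries F i = ddiff F (Suc i) ` fmod F (Suc i)"

definition graded_free_resolution :: "'k::field polyA dgfree \<Rightarrow> 'k polyA set \<Rightarrow> bool" where
  "graded_free_resolution F I \<longleftrightarrow>
     rk F 0 = 1 \<and> gdeg F 0 0 = 0 \<and>
     (\<forall>i>0. \<forall>j<rk F (i - 1). \<forall>k<rk F i.
        homogeneous (gdeg F i k - gdeg F (i - 1) j) (dmat F i j k)) \<and>
     (\<lambda>v. v 0) ` boundaries F 0 = I \<and>
     (\<forall>i>0. cycles F i = boundaries F i)"

definition minimal_complex :: "'k::field polyA dgfree \<Rightarrow> bool" where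
  "minimal_complex F \<longleftrightarrow>
     (\<forall>i>0. \<forall>j<rk F (i - 1). \<forall>k<rk F i. dmat F i j k \<in> irrelevant_ideal)"

text \<open>In the Leibniz rule the terms with \<open>p = 0\<close> or \<open>q = 0\<close> containing \<open>p - 1\<close> or \<open>q - 1\<close> vanish, since
  the differential is zero on degree \<open>0\<close>.\<close>

definition graded_dga :: "'k::field polyA dgfree \<Rightarrow> bool" where
  "graded_dga F \<longleftrightarrow>
     (\<forall>p q. \<forall>i<rk F p. \<forall>j<rk F q. \<forall>k<rk F (p + q).
        homogeneous (gdeg F p i + gdeg F q j - gdeg F (p + q) k) (sc F p q i j k)) \<and>
     (\<forall>q. \<forall>w\<in>fmod F q. dmult F 0 q unitv w = w) \<and>
     (\<forall>p q. \<forall>v\<in>fmod F p. \<forall>w\<in>fmod F q. \<forall>k.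
        dmult F p q v w k = (- 1) ^ (p * q) * dmult F q p w v k) \<and>
     (\<forall>p q r. \<forall>a\<in>fmod F p. \<forall>b\<in>fmod F q. \<forall>c\<in>fmod F r.
        dmult F (p + q) r (dmult F p q a b) c = dmult F p (q + r) a (dmult F q r b c)) \<and>
     (\<forall>p q. \<forall>v\<in>fmod F p. \<forall>w\<in>fmod F q. \<forall>k.
        ddiff F (p + q) (dmult F p q v w) k =
          dmult F (p - 1) q (ddiff F p v) w k + (- 1) ^ p * dmult F p (q - 1) v (ddiff F q w) k)"

definition min_dga_resolution :: "'k::field polyA dgfree \<Rightarrow> 'k polyA set \<Rightarrow> bool" where
  "min_dga_resolution F I \<longleftrightarrow>
     graded_free_resolution F I \<and> minimal_complex F \<and> (\<forall>i>3. rk F i = 0) \<and> graded_dga F"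


section \<open>The Tor algebra\<close>

definition base_change :: "('a \<Rightarrow> 'b) \<Rightarrow> 'a dgfree \<Rightarrow> 'b dgfree" where
  "base_change h F = \<lparr>rk = rk F, gdeg = gdeg F,
     dmat = (\<lambda>i j k. h (dmat F i j k)), sc = (\<lambda>p q i j k. h (sc F p q i j k))\<rparr>"

abbreviation tensor_K :: "'k::field polyA dgfree \<Rightarrow> 'k dgfree" where
  "tensor_K F \<equiv> base_change const_coeff F"

text \<open>Homology classes are cosets of the boundaries, and the product of two classes is
  induced by the product of representatives.\<close>

definition hclass :: "'a::comm_ring_1 dgfree \<Rightarrow> nat \<Rightarrow> (nat \<Rightarrow> 'a) \<Rightarrow> (nat \<Rightarrow> 'a) set" where
  "hclass C i v = {w. (\<lambda>k. w k - v k) \<in> boundaries C i}"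

definition homology :: "'a::comm_ring_1 dgfree \<Rightarrow> nat \<Rightarrow> (nat \<Rightarrow> 'a) set set" where
  "homology C i = hclass C i ` cycles C i"

definition hmult ::
  "'a::comm_ring_1 dgfree \<Rightarrow> nat \<Rightarrow> nat \<Rightarrow> (nat \<Rightarrow> 'a) set \<Rightarrow> (nat \<Rightarrow> 'a) set \<Rightarrow> (nat \<Rightarrow> 'a) set" where
  "hmult C p q X Y = (\<Union>v\<in>X. \<Union>w\<in>Y. hclass C (p + q) (dmult C p q v w))"

definition Tor :: "'k::field polyA dgfree \<Rightarrow> nat \<Rightarrow> (nat \<Rightarrow> 'k) set set" where
  "Tor F i = homology (tensor_K F) i"

definition Tor_mult ::
  "'k::field polyA dgfree \<Rightarrow> nat \<Rightarrow> nat \<Rightarrow> (nat \<Rightarrow> 'k) set \<Rightarrow> (nat \<Rightarrow> 'k) set \<Rightarrow> (nat \<Rightarrow> 'k) set" where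
  "Tor_mult F p q X Y = hmult (tensor_K F) p q X Y"

definition Tor_zero :: "'k::field polyA dgfree \<Rightarrow> nat \<Rightarrow> (nat \<Rightarrow> 'k) set" where
  "Tor_zero F i = hclass (tensor_K F) i zerov"


section \<open>The residue field\<close>

lemma module_mult: "module ((*) :: 'a::comm_ring_1 \<Rightarrow> 'a \<Rightarrow> 'a)"
  by unfold_locales (auto simp: algebra_simps)

lemma const_coeff_mult:
  fixes p q :: "'k::comm_ring_1 polyA"
  shows "const_coeff (p * q) = const_coeff p * const_coeff q"
proof -
  have zero: "(0 = l + r) \<longleftrightarrow> (l = 0 \<and> r = 0)" for l r :: mono
  proof
    assume "0 = l + r"
    then have "Poly_Mapping.lookup l v + Poly_Mapping.lookup r v = 0" for v
      by (metis lookup_add lookup_zero)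
    then show "l = 0 \<and> r = 0"
      by (auto intro!: poly_mapping_eqI)
  qed simp
  have inner: "Sum_any (\<lambda>r. Poly_Mapping.lookup q r when 0 = l + r) = (Poly_Mapping.lookup q 0 when l = 0)" for l
  proof (cases "l = 0")
    case True
    then show ?thesis by (simp add: when_def)
  next
    case False
    then show ?thesis by (simp add: zero)
  qed
  show ?thesis
    unfolding const_coeff_def lookup_mult inner
    by (simp add: mult_when)
qed

lemma const_coeff_ring_hom:
  fixes p q :: "'k::comm_ring_1 polyA"
  shows "const_coeff (p + q) = const_coeff p + const_coeff q"
    and "const_coeff (p * q) = const_coeff p * const_coeff q"
    and "const_coeff (1 :: 'k polyA) = 1"
    and "surj (const_coeff :: 'k polyA \<Rightarrow> 'k)"
proof -
  show "surj (const_coeff :: 'k polyA \<Rightarrow> 'k)"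
    by (rule surjI[where f = "Poly_Mapping.single 0"]) (simp add: const_coeff_def)
qed (simp_all add: const_coeff_mult, simp_all add: const_coeff_def lookup_add lookup_one)

lemma kernel_const_coeff: "{p :: 'k::comm_ring_1 polyA. const_coeff p = 0} = irrelevant_ideal"
proof -
  interpret module "(*) :: 'k polyA \<Rightarrow> 'k polyA \<Rightarrow> 'k polyA" by (rule module_mult)
  have sub: "subspace {p :: 'k polyA. const_coeff p = 0}"
    by (auto simp: subspace_def const_coeff_mult) (auto simp: const_coeff_def lookup_add)
  have "const_coeff (var v :: 'k polyA) = 0" for v
  proof -
    have "Poly_Mapping.lookup (Poly_Mapping.single v (1::nat)) v \<noteq> Poly_Mapping.lookup 0 v"
      by simp
    then have "Poly_Mapping.single v (1::nat) \<noteq> 0" by metis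
    then show ?thesis by (simp add: const_coeff_def var_def lookup_single when_def)
  qed
  then have "irrelevant_ideal \<subseteq> {p :: 'k polyA. const_coeff p = 0}"
    unfolding irrelevant_ideal_def ideal_gen_def by (intro span_minimal sub) auto
  moreover have "p \<in> irrelevant_ideal" if p: "const_coeff p = 0" for p :: "'k polyA"
  proof -
    have mon: "Poly_Mapping.single m c \<in> span (range var)" if m: "m \<noteq> 0" for m and c :: 'k
    proof -
      obtain v where v: "Poly_Mapping.lookup m v \<noteq> 0"
        using m by (metis lookup_zero poly_mapping_eqI)
      define n where "n = m - Poly_Mapping.single v 1"
      have "m = n + Poly_Mapping.single v 1"
        using v by (intro poly_mapping_eqI) (auto simp: n_def lookup_add lookup_minus lookup_single when_def)
      then have "Poly_Mapping.single m c = Poly_Mapping.single n c * var v"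
        by (simp add: var_def mult_single)
      then show ?thesis by (simp add: span_scale span_base)
    qed
    have "p = (\<Sum>m\<in>Poly_Mapping.keys p. Poly_Mapping.single m (Poly_Mapping.lookup p m))"
      by (rule poly_mapping_eqI)
        (simp add: lookup_sum lookup_single when_def in_keys_iff)
    moreover have "(\<Sum>m\<in>Poly_Mapping.keys p. Poly_Mapping.single m (Poly_Mapping.lookup p m)) \<in> span (range var)"
      using p by (intro span_sum mon) (auto simp: const_coeff_def in_keys_iff)
    ultimately show ?thesis
      unfolding irrelevant_ideal_def ideal_gen_def by simp
  qed
  ultimately show ?thesis by auto
qed

end

theory Submission
  imports Defs
begin

text \<open>There is an explicit resolution with ranks \<open>1, 5, 6, 2\<close> whose generators have internal degrees
  \<open>3, 3, 3, 3, 4\<close>, then \<open>5\<close> six times, then \<open>7\<close> twice, and it carries an explicit multiplication.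
  The Leibniz rule makes multiplication by an element \<open>d e\<close> of the ideal homotopic to zero via
  multiplication by \<open>e\<close>, so the ideal annihilates the homology in positive degrees.  As the ideal
  contains a regular sequence of length \<open>3\<close> (found by coprime leading monomials after a linear change of
  variables) and the complex has length \<open>3\<close>, a diagram chase shows that the complex is exact.

  Any minimal graded free resolution has generators in the same internal degrees.  Hence products
  \<open>F\<^sub>1 F\<^sub>1\<close> have degree at least \<open>6 > 5\<close> and products \<open>F\<^sub>1 F\<^sub>2\<close> have degree at least \<open>8 > 7\<close>, so that all
  structure constants have positive degree, whatever multiplication is chosen.\<close>

section \<open>Polynomials with given leading monomials\<close>

text \<open>Exactness of one explicit complex is the heart: only then are the degrees 5 and 7 known
  for every minimal resolution. No criterion on ranks and minors is used; the product on the complex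
  supplies the homotopies, so the same data give both existence and exactness. The formulas come
  from linear algebra. Let X, Y be the skew-symmetric 4 by 4 matrices of the x and y variables and
  X', Y' their Pfaffian duals. Then X' X = - a I, Y' Y = - c I, and polarizing gives X' Y + Y' X = -
  b I. Hence M = Y' X - X' Y satisfies M^2 = (b^2 - 4 a c) I. Applied to the vector Z of the z
  variables, M yields the four cubic generators up to sign, and all differentials and products are
  assembled from M, X, Y, X', Y', Z and a, b, c. Characteristic zero enters through the leading
  coefficient - 2 of two members of the regular sequence.\<close>

lemma sum_monomials:
  "(\<Sum>k\<in>Poly_Mapping.keys p. Poly_Mapping.single k (Poly_Mapping.lookup p k)) = p"
  by (rule poly_mapping_eqI) (simp add: lookup_sum lookup_single when_def in_keys_iff)

text \<open>Additivity in each argument reduces claims about products and substitutions to single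
  monomials, which avoids convolution sums.\<close>

lemma poly_mapping_additive_induct [case_names single add]:
  fixes p :: "'a \<Rightarrow>\<^sub>0 'b::comm_monoid_add"
  assumes single: "\<And>k c. P (Poly_Mapping.single k c)"
    and add: "\<And>p q. P p \<Longrightarrow> P q \<Longrightarrow> P (p + q)"
  shows "P p"
proof -
  have P0: "P 0" using single[of undefined 0] by simp
  have "P (\<Sum>k\<in>S. Poly_Mapping.single k (f k))" if "finite S" for S and f :: "'a \<Rightarrow> 'b"
    using that by (induction S rule: finite_induct) (simp_all add: P0 single add)
  from this[of "Poly_Mapping.keys p" "Poly_Mapping.lookup p"] show ?thesis
    by (simp add: sum_monomials)
qed

lemma lookup_mult_single_eq:
  fixes p :: "'a::cancel_comm_monoid_add \<Rightarrow>\<^sub>0 'b::comm_semiring_1"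
  shows "Poly_Mapping.lookup (p * Poly_Mapping.single m c) (l + m) = Poly_Mapping.lookup p l * c"
  by (induction p rule: poly_mapping_additive_induct)
    (auto simp: mult_single lookup_single when_def distrib_right lookup_add)

lemma lookup_mult_single_eq_0:
  fixes p :: "'a::cancel_comm_monoid_add \<Rightarrow>\<^sub>0 'b::comm_semiring_1"
  assumes "\<nexists>l. t = l + m"
  shows "Poly_Mapping.lookup (p * Poly_Mapping.single m c) t = 0"
  using assms by (induction p rule: poly_mapping_additive_induct)
    (auto simp: mult_single lookup_single when_def distrib_right lookup_add)

text \<open>An additive weight replaces a monomial order: ties between monomials are harmless as
  long as each divisor has a single monomial of top weight, and induction on natural numbers
  replaces well-foundedness of an order.\<close>

locale monomial_weight =
  fixes wt :: "'a::cancel_comm_monoid_add \<Rightarrow> nat"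
  assumes wt_add: "wt (m + n) = wt m + wt n"
begin

text \<open>The strict inequality excludes \<open>m\<close> itself from the tail, so
  \<open>c\<close> is the whole coefficient of \<open>m\<close> in \<open>D\<close>.\<close>

definition leading :: "('a \<Rightarrow>\<^sub>0 'b::field) \<Rightarrow> 'a \<Rightarrow> 'b \<Rightarrow> bool" where
  "leading D m c \<longleftrightarrow> c \<noteq> 0 \<and> (\<forall>k\<in>Poly_Mapping.keys (D - Poly_Mapping.single m c). wt k < wt m)"

definition reduced :: "'a \<Rightarrow> ('a \<Rightarrow>\<^sub>0 'b::field) \<Rightarrow> bool" where
  "reduced m p \<longleftrightarrow> (\<forall>l. Poly_Mapping.lookup p (l + m) = 0)"

text \<open>Monomials are written additively: every common multiple of \<open>m\<close> and
  \<open>n\<close> is a multiple of their product \<open>m + n\<close>.\<close>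

definition coprime_mono :: "'a \<Rightarrow> 'a \<Rightarrow> bool" where
  "coprime_mono m n \<longleftrightarrow> (\<forall>k l. k + m = l + n \<longrightarrow> (\<exists>j. k = j + n))"

lemma coprime_mono_sym: "coprime_mono m n \<Longrightarrow> coprime_mono n m"
  unfolding coprime_mono_def
  by (metis add.assoc add.commute add_right_cancel)

lemma reduced_add: "reduced m p \<Longrightarrow> reduced m q \<Longrightarrow> reduced m (p + q)"
  by (simp add: reduced_def lookup_add)

lemma lookup_mult_small:
  fixes p R :: "'a \<Rightarrow>\<^sub>0 'b::field"
  assumes "\<forall>k\<in>Poly_Mapping.keys R. wt k < w" "\<forall>k\<in>Poly_Mapping.keys p. wt k + w \<le> wt t"
  shows "Poly_Mapping.lookup (p * R) t = 0"
proof (rule ccontr)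
  assume "Poly_Mapping.lookup (p * R) t \<noteq> 0"
  then have "t \<in> Poly_Mapping.keys (p * R)" by (simp add: in_keys_iff)
  then obtain a b where "t = a + b" "a \<in> Poly_Mapping.keys p" "b \<in> Poly_Mapping.keys R"
    using keys_mult[of p R] by blast
  with assms show False using wt_add[of a b] by fastforce
qed

text \<open>At weights this high the tail of \<open>D\<close> cannot contribute, so \<open>D\<close>
  may be replaced by its leading term.\<close>

lemma lookup_mult_leading:
  fixes p D :: "'a \<Rightarrow>\<^sub>0 'b::field"
  assumes "leading D m c" "\<forall>k\<in>Poly_Mapping.keys p. wt k + wt m \<le> wt t"
  shows "Poly_Mapping.lookup (p * D) t = Poly_Mapping.lookup (p * Poly_Mapping.single m c) t"
proof -
  have "p * D = p * Poly_Mapping.single m c + p * (D - Poly_Mapping.single m c)"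
    by (simp add: algebra_simps)
  moreover have "Poly_Mapping.lookup (p * (D - Poly_Mapping.single m c)) t = 0"
    using assms by (intro lookup_mult_small[of _ "wt m"]) (auto simp: leading_def)
  ultimately show ?thesis by (simp add: lookup_add)
qed

text \<open>Rewriting a multiple of a leading monomial leaves only terms of smaller weight, so
  induction on the weight terminates. Uniqueness of the remainder is not claimed; for coprime
  leading monomials it is recovered in \<open>reduced_relation_trivial\<close>.\<close>

lemma division_two:
  fixes p D E :: "'a \<Rightarrow>\<^sub>0 'b::field"
  assumes D: "leading D m c" and E: "leading E n d"
  shows "\<exists>a b r. p = a * D + b * E + r \<and> reduced m r \<and> reduced n r"
proof -
  define good where "good p \<longleftrightarrow> (\<exists>a b r. p = a * D + b * E + r \<and> reduced m r \<and> reduced n r)"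
    for p :: "'a \<Rightarrow>\<^sub>0 'b"
  have good_add: "good (p + q)" if "good p" "good q" for p q
  proof -
    from that obtain a b r a' b' r' where
      "p = a * D + b * E + r" "q = a' * D + b' * E + r'"
      "reduced m (r + r')" "reduced n (r + r')"
      unfolding good_def using reduced_add by blast
    then have "p + q = (a + a') * D + (b + b') * E + (r + r')"
      by (simp add: algebra_simps)
    then show ?thesis unfolding good_def using \<open>reduced m (r + r')\<close> \<open>reduced n (r + r')\<close> by blast
  qed
  have good_mult: "good (a * D)" "good (a * E)" for a
    unfolding good_def
    by (rule exI[of _ a], rule exI[of _ 0], rule exI[of _ 0], simp add: reduced_def)
      (rule exI[of _ 0], rule exI[of _ a], rule exI[of _ 0], simp add: reduced_def)
  have good_sum: "good p" if *: "\<And>k. k \<in> Poly_Mapping.keys p \<Longrightarrow> good (Poly_Mapping.single k (Poly_Mapping.lookup p k))" for p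
  proof -
    have "good 0" using good_mult(1)[of 0] by simp
    have "good (\<Sum>k\<in>S. Poly_Mapping.single k (Poly_Mapping.lookup p k))"
      if "finite S" "S \<subseteq> Poly_Mapping.keys p" for S
      using that(1,2)
    proof (induction S rule: finite_induct)
      case empty
      with \<open>good 0\<close> show ?case by simp
    next
      case (insert k S)
      then have "good (Poly_Mapping.single k (Poly_Mapping.lookup p k))" by (intro *) simp
      with insert show ?case by (simp add: good_add)
    qed
    from this[of "Poly_Mapping.keys p"] show ?thesis by (simp add: sum_monomials)
  qed
  \<comment> \<open>Stated for an arbitrary divisor \<open>F\<close> because it is applied to both
    \<open>D\<close> and \<open>E\<close>.\<close>
  have step: "good (Poly_Mapping.single (l + m') x)"
    if IH: "\<And>k x. wt k < wt (l + m') \<Longrightarrow> good (Poly_Mapping.single k x)"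
      and F: "leading F m' c'" and gF: "\<And>a. good (a * F)" for l m' x F c'
  proof -
    define q where "q = Poly_Mapping.single l (x / c')"
    define R where "R = q * (F - Poly_Mapping.single m' c')"
    have "Poly_Mapping.single (l + m') x = q * F + (- R)"
      using F by (simp add: R_def q_def leading_def algebra_simps mult_single)
    moreover have "good (- R)"
    proof (rule good_sum, rule IH)
      fix k assume "k \<in> Poly_Mapping.keys (- R)"
      then have "k \<in> Poly_Mapping.keys R" by (simp add: in_keys_iff)
      then obtain a b where "k = a + b" "a \<in> Poly_Mapping.keys q"
        "b \<in> Poly_Mapping.keys (F - Poly_Mapping.single m' c')"
        unfolding R_def using keys_mult[of q] by blast
      with F show "wt k < wt (l + m')"
        by (auto simp: q_def leading_def wt_add split: if_splits)
    qed
    ultimately show ?thesis using gF good_add by metis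
  qed
  have "good (Poly_Mapping.single k x)" for k x
  proof (induction "wt k" arbitrary: k x rule: less_induct)
    case less
    consider l where "k = l + m" | l where "k = l + n" | "\<nexists>l. k = l + m" "\<nexists>l. k = l + n" by blast
    then show ?case
    proof cases
      case 1
      with step[OF _ D good_mult(1)] less show ?thesis by blast
    next
      case 2
      with step[OF _ E good_mult(2)] less show ?thesis by blast
    next
      case 3
      then have "reduced m (Poly_Mapping.single k x)" "reduced n (Poly_Mapping.single k x)"
        by (auto simp: reduced_def lookup_single when_def)
      then show ?thesis unfolding good_def
        by (intro exI[of _ 0] exI[of _ "Poly_Mapping.single k x"]) auto
    qed
  qed
  then have "good p" by (rule good_sum)
  then show ?thesis unfolding good_def .
qed

lemma division:
  fixes p D :: "'a \<Rightarrow>\<^sub>0 'b::field"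
  assumes D: "leading D m c"
  shows "\<exists>a r. p = a * D + r \<and> reduced m r"
  proof -
  obtain a b r where "p = a * D + b * D + r" "reduced m r"
    using division_two[OF D D, of p] by blast
  then have "p = (a + b) * D + r \<and> reduced m r" by (simp add: distrib_right)
  then show ?thesis by blast
qed

text \<open>In top weight the first summand consists of multiples of \<open>m1\<close>, whereas
  coprimality and reducedness keep multiples of \<open>m1\<close> out of the other two; so it
  vanishes there. Then \<open>m2\<close> separates the second summand from the third in the same
  way, and the third is left alone. Thus no top weight can exist.\<close>

lemma reduced_relation_trivial:
  fixes a b e D1 D2 D3 :: "'a \<Rightarrow>\<^sub>0 'b::field"
  assumes D: "leading D1 m1 c1" "leading D2 m2 c2" "leading D3 m3 c3"
    and cop: "coprime_mono m1 m2" "coprime_mono m1 m3" "coprime_mono m2 m3"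
    and red: "reduced m1 b" "reduced m1 e" "reduced m2 e"
    and rel: "a * D1 + b * D2 + e * D3 = 0"
  shows "a = 0 \<and> b = 0 \<and> e = 0"
proof -
  \<comment> \<open>\<open>N\<close> is a strict bound on the weights of all monomials of the three
    coefficients, each shifted by its leading monomial; the induction lowers it to 0, where no
    monomial is left.\<close>
  have main: "(\<forall>k\<in>Poly_Mapping.keys a. wt k + wt m1 < N) \<and> (\<forall>k\<in>Poly_Mapping.keys b. wt k + wt m2 < N)
      \<and> (\<forall>k\<in>Poly_Mapping.keys e. wt k + wt m3 < N) \<Longrightarrow> ?thesis" for N
  proof (induction N)
    case 0
    then have "Poly_Mapping.keys a = {}" "Poly_Mapping.keys b = {}" "Poly_Mapping.keys e = {}" by blast+
    moreover have "Poly_Mapping.keys p = {} \<Longrightarrow> p = 0" for p :: "'a \<Rightarrow>\<^sub>0 'b"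
      by (metis sum_monomials sum.empty)
    ultimately show ?case by blast
  next
    case (Suc N)
    have top: "Poly_Mapping.lookup (a * Poly_Mapping.single m1 c1) t
        + Poly_Mapping.lookup (b * Poly_Mapping.single m2 c2) t
        + Poly_Mapping.lookup (e * Poly_Mapping.single m3 c3) t = 0" if "wt t = N" for t
    proof -
      have "Poly_Mapping.lookup (a * D1 + b * D2 + e * D3) t = 0" using rel by simp
      moreover have "Poly_Mapping.lookup (a * D1) t = Poly_Mapping.lookup (a * Poly_Mapping.single m1 c1) t"
        "Poly_Mapping.lookup (b * D2) t = Poly_Mapping.lookup (b * Poly_Mapping.single m2 c2) t"
        "Poly_Mapping.lookup (e * D3) t = Poly_Mapping.lookup (e * Poly_Mapping.single m3 c3) t"
        using Suc.prems that by (auto intro!: lookup_mult_leading D simp: less_Suc_eq_le)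
      ultimately show ?thesis by (simp add: lookup_add)
    qed
    \<comment> \<open>If \<open>l + m = k + n\<close>, coprimality makes \<open>k\<close> a multiple
      of \<open>m\<close>, and there the reduced polynomial has coefficient 0.\<close>
    have not1: "Poly_Mapping.lookup (b * Poly_Mapping.single m2 c2) (l + m1) = 0"
       "Poly_Mapping.lookup (e * Poly_Mapping.single m3 c3) (l + m1) = 0"
       "Poly_Mapping.lookup (e * Poly_Mapping.single m3 c3) (l + m2) = 0" for l
    proof -
      have *: "Poly_Mapping.lookup (p * Poly_Mapping.single n d) (l + m) = 0"
        if "coprime_mono m n" "reduced m p" for p :: "'a \<Rightarrow>\<^sub>0 'b" and m n d
      proof (cases "\<exists>k. l + m = k + n")
        case True
        then obtain k where k: "k + n = l + m" by metis
        with coprime_mono_sym[OF that(1)] obtain j where "k = j + m"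
          unfolding coprime_mono_def by blast
        with k that(2) lookup_mult_single_eq[of p n d k] show ?thesis
          by (simp add: reduced_def)
      next
        case False
        then show ?thesis by (rule lookup_mult_single_eq_0)
      qed
      show "Poly_Mapping.lookup (b * Poly_Mapping.single m2 c2) (l + m1) = 0"
       "Poly_Mapping.lookup (e * Poly_Mapping.single m3 c3) (l + m1) = 0"
       "Poly_Mapping.lookup (e * Poly_Mapping.single m3 c3) (l + m2) = 0"
        using * cop red by blast+
    qed
    have A: "wt k + wt m1 < N" if "k \<in> Poly_Mapping.keys a" for k
    proof (rule ccontr)
      assume "\<not> wt k + wt m1 < N"
      with Suc.prems that have "wt (k + m1) = N" by (auto simp: wt_add less_Suc_eq)
      from top[OF this] not1(1,2) D(1) that show False
        by (auto simp: lookup_mult_single_eq leading_def in_keys_iff)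
    qed
    have a0: "Poly_Mapping.lookup (a * Poly_Mapping.single m1 c1) t = 0" if "wt t = N" for t
    proof (cases "\<exists>l. t = l + m1")
      case True
      then obtain l where "t = l + m1" by blast
      moreover from this have "l \<notin> Poly_Mapping.keys a"
        using A[of l] that by (auto simp: wt_add)
      ultimately show ?thesis by (simp add: lookup_mult_single_eq in_keys_iff)
    qed (rule lookup_mult_single_eq_0)
    have B: "wt k + wt m2 < N" if "k \<in> Poly_Mapping.keys b" for k
    proof (rule ccontr)
      assume "\<not> wt k + wt m2 < N"
      with Suc.prems that have "wt (k + m2) = N" by (auto simp: wt_add less_Suc_eq)
      from top[OF this] a0[OF this] not1(3) D(2) that show False
        by (auto simp: lookup_mult_single_eq leading_def in_keys_iff)
    qed
    have b0: "Poly_Mapping.lookup (b * Poly_Mapping.single m2 c2) t = 0" if "wt t = N" for t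
    proof (cases "\<exists>l. t = l + m2")
      case True
      then obtain l where "t = l + m2" by blast
      moreover from this have "l \<notin> Poly_Mapping.keys b"
        using B[of l] that by (auto simp: wt_add)
      ultimately show ?thesis by (simp add: lookup_mult_single_eq in_keys_iff)
    qed (rule lookup_mult_single_eq_0)
    have C: "wt k + wt m3 < N" if "k \<in> Poly_Mapping.keys e" for k
    proof (rule ccontr)
      assume "\<not> wt k + wt m3 < N"
      with Suc.prems that have "wt (k + m3) = N" by (auto simp: wt_add less_Suc_eq)
      from top[OF this] a0[OF this] b0[OF this] D(3) that show False
        by (auto simp: lookup_mult_single_eq leading_def in_keys_iff)
    qed
    from A B C show ?case by (intro Suc.IH) blast
  qed
  define f where "f p m = (\<lambda>k. wt k + wt m) ` Poly_Mapping.keys p" for p :: "'a \<Rightarrow>\<^sub>0 'b" and m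
  have "finite (f a m1 \<union> f b m2 \<union> f e m3)" by (simp add: f_def)
  then obtain N where "\<forall>n\<in>f a m1 \<union> f b m2 \<union> f e m3. n < N"
    using finite_nat_set_iff_bounded by blast
  then show ?thesis by (intro main[of N]) (auto simp: f_def)
qed

end

text \<open>The clauses say that each element is a nonzerodivisor modulo its predecessors, spelled
  out with elements so that a diagram chase can use them directly.\<close>

definition regular3 :: "'a::comm_ring_1 \<Rightarrow> 'a \<Rightarrow> 'a \<Rightarrow> bool" where
  "regular3 D1 D2 D3 \<longleftrightarrow>
     (\<forall>a. D1 * a = 0 \<longrightarrow> a = 0) \<and>
     (\<forall>a b. D2 * a = D1 * b \<longrightarrow> (\<exists>p. a = D1 * p)) \<and>
     (\<forall>a b c. D3 * a = D1 * b + D2 * c \<longrightarrow> (\<exists>p q. a = D1 * p + D2 * q))"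

text \<open>Replacing the unknown by its remainder, and the coefficient of \<open>D2\<close> by its
  remainder modulo \<open>D1\<close>, turns each hypothesis into a relation with reduced
  coefficients, which must be trivial.\<close>

lemma (in monomial_weight) regular3_if_coprime_leading:
  fixes D1 D2 D3 :: "'a \<Rightarrow>\<^sub>0 'b::field"
  assumes D: "leading D1 m1 c1" "leading D2 m2 c2" "leading D3 m3 c3"
    and cop: "coprime_mono m1 m2" "coprime_mono m1 m3" "coprime_mono m2 m3"
  shows "regular3 D1 D2 D3"
  unfolding regular3_def
proof (intro conjI allI impI)
  note triv = reduced_relation_trivial[OF D cop]
  have red0: "reduced m 0" for m by (simp add: reduced_def)
  show "a = 0" if "D1 * a = 0" for a
    \<comment> \<open>The variables of \<open>triv\<close> occur in the order \<open>b\<close>,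
      \<open>e\<close>, \<open>a\<close>, so the last argument is the coefficient of
      \<open>D1\<close>.\<close>
    using triv[of 0 0 a, OF red0 red0 red0] that by (simp add: mult.commute)
  show "\<exists>p. a = D1 * p" if ab: "D2 * a = D1 * b" for a b
  proof -
    obtain p r where a: "a = p * D1 + r" and r: "reduced m1 r"
      using division[OF D(1)] by blast
    have "(p * D2 - b) * D1 + r * D2 + 0 * D3 = 0"
      using ab by (simp add: a algebra_simps)
    with triv[of r 0] r red0 have "r = 0" by blast
    with a show ?thesis by (auto simp: mult.commute)
  qed
  show "\<exists>p q. a = D1 * p + D2 * q" if abc: "D3 * a = D1 * b + D2 * c" for a b c
  proof -
    obtain p q r where a: "a = p * D1 + q * D2 + r" and r: "reduced m1 r" "reduced m2 r"
      using division_two[OF D(1,2)] by blast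
    \<comment> \<open>Everything multiplying \<open>D2\<close> is collected in
      \<open>q * D3 - c\<close> and divided by \<open>D1\<close>; the quotient is absorbed into the
      coefficient of \<open>D1\<close>.\<close>
    obtain s t where st: "q * D3 - c = s * D1 + t" and t: "reduced m1 t"
      using division[OF D(1)] by blast
    have "(p * D3 - b + s * D2) * D1 + t * D2 + r * D3
        = (p * D3 - b) * D1 + (s * D1 + t) * D2 + r * D3" by (simp add: algebra_simps)
    also have "\<dots> = D3 * (p * D1 + q * D2 + r) - (D1 * b + D2 * c)"
      unfolding st[symmetric] by (simp add: algebra_simps)
    finally have "(p * D3 - b + s * D2) * D1 + t * D2 + r * D3 = 0"
      using abc a by simp
    with triv[of t r] r t have "r = 0" by blast
    with a have "a = D1 * p + D2 * q" by (simp add: mult.commute)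
    then show ?thesis by blast
  qed
qed

section \<open>Substitutions\<close>

definition mono_subst :: "('v \<Rightarrow> 'a) \<Rightarrow> ('v \<Rightarrow>\<^sub>0 nat) \<Rightarrow> 'a::comm_monoid_mult" where
  "mono_subst \<sigma> m = (\<Prod>v\<in>Poly_Mapping.keys m. \<sigma> v ^ Poly_Mapping.lookup m v)"

lemma mono_subst_superset:
  assumes "finite S" "Poly_Mapping.keys m \<subseteq> S"
  shows "mono_subst \<sigma> m = (\<Prod>v\<in>S. \<sigma> v ^ Poly_Mapping.lookup m v)"
  unfolding mono_subst_def using assms
  by (intro prod.mono_neutral_left) (auto simp: in_keys_iff)

lemma mono_subst_add: "mono_subst \<sigma> (m + n) = mono_subst \<sigma> m * mono_subst \<sigma> n"
proof -
  let ?S = "Poly_Mapping.keys m \<union> Poly_Mapping.keys n"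
  have "mono_subst \<sigma> k = (\<Prod>v\<in>?S. \<sigma> v ^ Poly_Mapping.lookup k v)" if "k \<in> {m, n, m + n}" for k
    using that keys_add[of m n] by (intro mono_subst_superset) auto
  then show ?thesis by (simp add: lookup_add power_add prod.distrib)
qed

definition subst :: "('v \<Rightarrow> (('w \<Rightarrow>\<^sub>0 nat) \<Rightarrow>\<^sub>0 'k)) \<Rightarrow> (('v \<Rightarrow>\<^sub>0 nat) \<Rightarrow>\<^sub>0 'k) \<Rightarrow> (('w \<Rightarrow>\<^sub>0 nat) \<Rightarrow>\<^sub>0 'k::comm_ring_1)"
  where "subst \<sigma> p = (\<Sum>m\<in>Poly_Mapping.keys p. Poly_Mapping.single 0 (Poly_Mapping.lookup p m) * mono_subst \<sigma> m)"

lemma subst_single: "subst \<sigma> (Poly_Mapping.single m c) = Poly_Mapping.single 0 c * mono_subst \<sigma> m"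
  by (simp add: subst_def)

lemma subst_superset:
  assumes "finite S" "Poly_Mapping.keys p \<subseteq> S"
  shows "subst \<sigma> p = (\<Sum>m\<in>S. Poly_Mapping.single 0 (Poly_Mapping.lookup p m) * mono_subst \<sigma> m)"
  unfolding subst_def using assms
  by (intro sum.mono_neutral_left) (auto simp: in_keys_iff)

lemma subst_add: "subst \<sigma> (p + q) = subst \<sigma> p + subst \<sigma> q"
proof -
  let ?S = "Poly_Mapping.keys p \<union> Poly_Mapping.keys q"
  have "subst \<sigma> r = (\<Sum>m\<in>?S. Poly_Mapping.single 0 (Poly_Mapping.lookup r m) * mono_subst \<sigma> m)"
    if "r \<in> {p, q, p + q}" for r
    using that keys_add[of p q] by (intro subst_superset) auto
  then show ?thesis by (simp add: lookup_add single_add distrib_right sum.distrib)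
qed

lemma subst_mult:
  fixes p q :: "('v \<Rightarrow>\<^sub>0 nat) \<Rightarrow>\<^sub>0 'k::comm_ring_1"
    and \<sigma> :: "'v \<Rightarrow> (('w \<Rightarrow>\<^sub>0 nat) \<Rightarrow>\<^sub>0 'k)"
  shows "subst \<sigma> (p * q) = subst \<sigma> p * subst \<sigma> q"
proof (induction p rule: poly_mapping_additive_induct)
  case (single k c)
  show ?case
  proof (induction q rule: poly_mapping_additive_induct)
    case (single l d)
    have "subst \<sigma> (Poly_Mapping.single k c * Poly_Mapping.single l d)
        = Poly_Mapping.single 0 (c * d) * (mono_subst \<sigma> k * mono_subst \<sigma> l)"
      by (simp add: mult_single subst_single mono_subst_add)
    also have "\<dots> = Poly_Mapping.single 0 c * Poly_Mapping.single 0 d * (mono_subst \<sigma> k * mono_subst \<sigma> l)"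
      by (simp add: mult_single)
    also have "\<dots> = Poly_Mapping.single 0 c * mono_subst \<sigma> k * (Poly_Mapping.single 0 d * mono_subst \<sigma> l)"
      by (simp only: mult_ac)
    finally show ?case by (simp only: subst_single)
  qed (simp add: distrib_left subst_add)
qed (simp add: distrib_right subst_add)

lemma subst_uminus: "subst \<sigma> (- p) = - subst \<sigma> p"
  using subst_add[of \<sigma> p "- p"] by (simp add: subst_def eq_neg_iff_add_eq_0 add.commute)

lemma subst_diff: "subst \<sigma> (p - q) = subst \<sigma> p - subst \<sigma> q"
  using subst_add[of \<sigma> p "- q"] by (simp add: subst_uminus)

lemma subst_const: "subst \<sigma> (Poly_Mapping.single 0 c) = Poly_Mapping.single 0 c"
  by (simp add: subst_single mono_subst_def)

lemma subst_numeral: "subst \<sigma> (numeral n) = numeral n"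
  using subst_const[of \<sigma> "numeral n"] by simp

lemma subst_var: "subst \<sigma> (var v) = \<sigma> v"
  by (simp add: var_def subst_single mono_subst_def)

lemma subst_power: "subst \<sigma> (p ^ n) = subst \<sigma> p ^ n"
  by (induction n) (simp_all add: subst_mult subst_const flip: single_one)

lemmas subst_simps = subst_add subst_mult subst_uminus subst_diff subst_numeral subst_var subst_power

text \<open>Monomials are products of variables, so constants and variables decide. This lets an
  inverse substitution be checked on variables alone.\<close>

lemma ring_hom_identity:
  fixes h :: "'k::comm_ring_1 polyA \<Rightarrow> 'k polyA"
  assumes add: "\<And>p q. h (p + q) = h p + h q" and mult: "\<And>p q. h (p * q) = h p * h q"
    and const: "\<And>c. h (Poly_Mapping.single 0 c) = Poly_Mapping.single 0 c"
    and var: "\<And>v. h (var v) = var v"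
  shows "h p = p"
proof (induction p rule: poly_mapping_additive_induct)
  case (single k c)
  have "h (Poly_Mapping.single k 1) = Poly_Mapping.single k 1"
  proof (induction k rule: poly_mapping_additive_induct)
    case (single v n)
    show ?case
    proof (induction n)
      case (Suc n)
      have "Poly_Mapping.single (Poly_Mapping.single v (Suc n)) (1 :: 'k)
          = var v * Poly_Mapping.single (Poly_Mapping.single v n) 1"
        by (simp add: var_def mult_single flip: single_add)
      with Suc show ?case by (simp add: mult var)
    qed (use const[of 1] in simp)
  next
    case (add k l)
    have "Poly_Mapping.single (k + l) (1 :: 'k) = Poly_Mapping.single k 1 * Poly_Mapping.single l 1"
      by (simp add: mult_single)
    with add show ?case by (simp add: mult)
  qed
  moreover have "Poly_Mapping.single k c = Poly_Mapping.single 0 c * Poly_Mapping.single k 1"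
    by (simp add: mult_single)
  ultimately show ?case by (simp add: mult const)
qed (simp add: add)

lemma subst_inverse:
  assumes "\<And>v. subst \<tau> (\<sigma> v) = var v"
  shows "subst \<tau> (subst \<sigma> p) = (p :: 'k::comm_ring_1 polyA)"
  by (rule ring_hom_identity[where h = "\<lambda>p. subst \<tau> (subst \<sigma> p)"])
    (simp_all add: subst_simps subst_const assms)

text \<open>Equations are pushed forward along \<open>\<sigma>\<close> and the witnesses pulled back
  along its inverse \<open>\<tau>\<close>.\<close>

lemma regular3_transfer:
  fixes D1 D2 D3 :: "'k::comm_ring_1 polyA"
  assumes inv: "\<And>p. subst \<tau> (subst \<sigma> p) = p" "\<And>p. subst \<sigma> (subst \<tau> p) = p"
    and reg: "regular3 (subst \<sigma> D1) (subst \<sigma> D2) (subst \<sigma> D3)"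
  shows "regular3 D1 D2 D3"
proof -
  have inj: "subst \<sigma> p = subst \<sigma> q \<longleftrightarrow> p = q" for p q by (metis inv(1))
  have zero: "subst \<sigma> 0 = 0" by (simp add: subst_def)
  show ?thesis
    unfolding regular3_def
  proof (intro conjI allI impI)
    show "a = 0" if "D1 * a = 0" for a
      using reg that unfolding regular3_def by (metis inj subst_mult zero)
    show "\<exists>p. a = D1 * p" if "D2 * a = D1 * b" for a b
    proof -
      have "subst \<sigma> D2 * subst \<sigma> a = subst \<sigma> D1 * subst \<sigma> b"
        using that by (metis subst_mult)
      then obtain p where "subst \<sigma> a = subst \<sigma> D1 * p"
        using reg unfolding regular3_def by blast
      then have "a = D1 * subst \<tau> p" by (metis inv subst_mult)
      then show ?thesis by blast
    qed
    show "\<exists>p q. a = D1 * p + D2 * q" if "D3 * a = D1 * b + D2 * c" for a b c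
    proof -
      have "subst \<sigma> D3 * subst \<sigma> a = subst \<sigma> D1 * subst \<sigma> b + subst \<sigma> D2 * subst \<sigma> c"
        using that by (metis subst_mult subst_add)
      then obtain p q where "subst \<sigma> a = subst \<sigma> D1 * p + subst \<sigma> D2 * q"
        using reg unfolding regular3_def by blast
      then have "a = D1 * subst \<tau> p + D2 * subst \<tau> q" by (metis inv subst_mult subst_add)
      then show ?thesis by blast
    qed
  qed
qed

section \<open>A regular sequence in the ideal\<close>

definition wdeg :: "('v \<Rightarrow> nat) \<Rightarrow> ('v \<Rightarrow>\<^sub>0 nat) \<Rightarrow> nat" where
  "wdeg W m = (\<Sum>v\<in>Poly_Mapping.keys m. W v * Poly_Mapping.lookup m v)"

lemma wdeg_add: "wdeg W (m + n) = wdeg W m + wdeg W n"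
  unfolding wdeg_def by (rule setsum_keys_plus_distrib) (simp_all add: algebra_simps)

lemma wdeg_single [simp]: "wdeg W (Poly_Mapping.single v n) = W v * n"
  by (simp add: wdeg_def)

interpretation wdeg: monomial_weight "wdeg W" for W
  by unfold_locales (rule wdeg_add)

lemma coprime_mono_if_disjoint:
  assumes "\<And>v. Poly_Mapping.lookup m v = 0 \<or> Poly_Mapping.lookup n v = 0"
  shows "wdeg.coprime_mono m (n :: 'v \<Rightarrow>\<^sub>0 nat)"
  unfolding wdeg.coprime_mono_def
proof (intro allI impI)
  fix k l assume "k + m = l + n"
  then have eq: "Poly_Mapping.lookup k v + Poly_Mapping.lookup m v
      = Poly_Mapping.lookup l v + Poly_Mapping.lookup n v" for v
    by (metis lookup_add)
  \<comment> \<open>Subtraction of exponents is truncated, but exact here: where \<open>n\<close> is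
    positive, \<open>m\<close> vanishes and \<open>k\<close> equals \<open>l + n\<close>.\<close>
  have "k = (k - n) + n"
  proof (rule poly_mapping_eqI)
    fix v show "Poly_Mapping.lookup k v = Poly_Mapping.lookup (k - n + n) v"
      using eq[of v] assms[of v] by (auto simp: lookup_add lookup_minus)
  qed
  then show "\<exists>j. k = j + n" by blast
qed

text \<open>Upper bounds compose along the syntax of an expression, so the tails below never have to
  be expanded into monomials.\<close>

definition wle :: "('v \<Rightarrow> nat) \<Rightarrow> nat \<Rightarrow> (('v \<Rightarrow>\<^sub>0 nat) \<Rightarrow>\<^sub>0 'k::comm_ring_1) \<Rightarrow> bool" where
  "wle W n p \<longleftrightarrow> (\<forall>m\<in>Poly_Mapping.keys p. wdeg W m \<le> n)"

lemma wle_mono: "wle W m p \<Longrightarrow> m \<le> n \<Longrightarrow> wle W n p"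
  by (force simp: wle_def)

lemma wle_var: "wle W (W v) (var v)"
  by (simp add: wle_def var_def)

lemma wle_numeral: "wle W 0 (numeral n)"
  by (simp add: wle_def wdeg_def flip: single_numeral)

lemma wle_uminus: "wle W m p \<Longrightarrow> wle W m (- p)"
  by (simp add: wle_def in_keys_iff)

lemma wle_add: "wle W m p \<Longrightarrow> wle W n q \<Longrightarrow> wle W (max m n) (p + q)"
  using keys_add[of p q] by (force simp: wle_def)

lemma wle_diff: "wle W m p \<Longrightarrow> wle W n q \<Longrightarrow> wle W (max m n) (p - q)"
  using wle_add[of W m p n "- q"] by (simp add: wle_uminus)

lemma wle_mult: "wle W m p \<Longrightarrow> wle W n q \<Longrightarrow> wle W (m + n) (p * q)"
  using keys_mult[of p q] by (force simp: wle_def wdeg_add)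

lemmas wle_rules = wle_var wle_numeral wle_uminus wle_add wle_diff wle_mult

lemma leadingI:
  assumes "wle W n R" "n < wdeg W m" "c \<noteq> 0" "D = Poly_Mapping.single m c + R"
  shows "wdeg.leading W D m c"
  using assms by (force simp: wdeg.leading_def wle_def)

text \<open>The shear is chosen so that the leading monomials of \<open>u134\<close>, \<open>u123\<close> and \<open>u_disc\<close> with
  respect to \<open>weight\<close> become the pairwise coprime \<open>z124 x34\<^sup>2\<close>, \<open>z234 x13 x24\<close> and \<open>x14\<^sup>2 y23\<^sup>2\<close>.\<close>

definition shear :: "'k::comm_ring_1 \<Rightarrow> var \<Rightarrow> 'k polyA" where
  "shear s v = (if v = VY P12 then vy P12 + Poly_Mapping.single 0 s * vx P24
     else if v = VY P13 then vy P13 + Poly_Mapping.single 0 s * vx P34 else var v)"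

lemma shear_inverse: "s + t = 0 \<Longrightarrow> subst (shear s) (subst (shear t) p) = p"
proof (rule subst_inverse)
  fix v assume "s + t = 0"
  then have *: "Poly_Mapping.single 0 s * p + Poly_Mapping.single 0 t * p = 0" for p :: "'a polyA"
    by (simp flip: distrib_right single_add)
  show "subst (shear s) (shear t v) = var v"
    using *[of "vx P24"] *[of "vx P34"]
    by (simp add: shear_def subst_simps subst_const add.assoc)
qed

text \<open>The intended leading monomials get weights 14, 13 and 16, while the remaining terms are
  bounded by 13, 12 and 15.\<close>

definition weight :: "var \<Rightarrow> nat" where
  "weight v = (if v \<in> {VX P24, VX P34} then 5
     else if v \<in> {VX P13, VX P14, VY P23, VZ T124, VZ T234} then 4 else 0)"

lemma shear_1 [simp]: 
  "shear 1 (VX p) = vx p" "shear 1 (VZ t) = vz t"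
  "shear 1 (VY P12) = vy P12 + vx P24" "shear 1 (VY P13) = vy P13 + vx P34"
  "shear 1 (VY P14) = vy P14" "shear 1 (VY P23) = vy P23" "shear 1 (VY P24) = vy P24"
  "shear 1 (VY P34) = vy P34"
  by (simp_all add: shear_def)

text \<open>Moves the leading coefficient into the ring numerals, where \<open>algebra_simps\<close>
  can compare it with the generators.\<close>

lemma single_minus_2: "Poly_Mapping.single m (- 2) = - 2 * Poly_Mapping.single m (1 :: 'k::comm_ring_1)"
proof -
  have "Poly_Mapping.single m (- 2 :: 'k) = - Poly_Mapping.single m (1 + 1)"
    by (simp add: single_uminus)
  also have "\<dots> = - 2 * Poly_Mapping.single m 1"
    by (simp only: single_add mult_2 minus_mult_left[symmetric])
  finally show ?thesis .
qed

text \<open>Squares appear as repeated summands and sums nest to the right, matching the products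
  that \<open>mult_single\<close> produces.\<close>

definition lm_u134 :: mono where "lm_u134 = Poly_Mapping.single (VZ T124) 1 + (Poly_Mapping.single (VX P34) 1 + Poly_Mapping.single (VX P34) 1)"
definition lm_u123 :: mono where "lm_u123 = Poly_Mapping.single (VZ T234) 1 + (Poly_Mapping.single (VX P13) 1 + Poly_Mapping.single (VX P24) 1)"
definition lm_u_disc :: mono where "lm_u_disc = Poly_Mapping.single (VX P14) 1 + (Poly_Mapping.single (VY P23) 1 + (Poly_Mapping.single (VX P14) 1 + Poly_Mapping.single (VY P23) 1))"

text \<open>The term \<open>- 2 z124 x34 y13\<close> of \<open>u134\<close> becomes
  \<open>- 2 z124 x34^2\<close> when \<open>x34\<close> is added to \<open>y13\<close>.\<close>

lemma leading_u134: "wdeg.leading weight (subst (shear 1) (u134 :: 'k::field_char_0 polyA)) lm_u134 (- 2)"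
proof (rule leadingI)
  let ?R = "2 * vz T234 * (vx P13 * vy P14 - vx P14 * (vy P13 + vx P34))
     + vz T134 * (- (vx P12 * vy P34 - vx P34 * (vy P12 + vx P24)) - (vx P13 * vy P24 - vx P24 * (vy P13 + vx P34))
        + (vx P14 * vy P23 - vx P23 * vy P14))
     + 2 * vz T124 * (vx P13 * vy P34 - vx P34 * vy P13) - 2 * vz T123 * (vx P14 * vy P34 - vx P34 * vy P14) :: 'k polyA"
  have "Poly_Mapping.single lm_u134 (- 2) = (- 2 * (vz T124 * (vx P34 * vx P34)) :: 'k polyA)"
    unfolding single_minus_2 by (simp add: lm_u134_def var_def mult_single)
  then show "subst (shear 1) u134 = Poly_Mapping.single lm_u134 (- 2) + ?R"
    by (simp add: u134_def delta1_def delta2_def delta3_def Delta_def subst_simps algebra_simps)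
  show "wle weight 13 ?R" by (rule wle_mono, (rule wle_rules)+, simp add: weight_def)
  show "13 < wdeg weight lm_u134" by (simp add: lm_u134_def wdeg_add weight_def)
qed simp

text \<open>The leading monomial arises from \<open>- 2 z234 x13 y12\<close> in
  \<open>- u123\<close> when \<open>x24\<close> is added to \<open>y12\<close>.\<close>

lemma leading_u123: "wdeg.leading weight (subst (shear 1) (- u123 :: 'k::field_char_0 polyA)) lm_u123 (- 2)"
proof (rule leadingI)
  let ?R = "2 * vz T234 * (vx P12 * (vy P13 + vx P34) - vx P13 * vy P12)
     - 2 * vz T134 * (vx P12 * vy P23 - vx P23 * (vy P12 + vx P24))
     + 2 * vz T124 * (vx P13 * vy P23 - vx P23 * (vy P13 + vx P34))
     - vz T123 * ((vx P13 * vy P24 - vx P24 * (vy P13 + vx P34)) - (vx P12 * vy P34 - vx P34 * (vy P12 + vx P24))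
        + (vx P14 * vy P23 - vx P23 * vy P14)) :: 'k polyA"
  have "Poly_Mapping.single lm_u123 (- 2) = (- 2 * (vz T234 * (vx P13 * vx P24)) :: 'k polyA)"
    unfolding single_minus_2 by (simp add: lm_u123_def var_def mult_single)
  then show "subst (shear 1) (- u123) = Poly_Mapping.single lm_u123 (- 2) + ?R"
    by (simp add: u123_def delta1_def delta2_def delta3_def Delta_def subst_simps algebra_simps)
  show "wle weight 12 ?R" by (rule wle_mono, (rule wle_rules)+, simp add: weight_def)
  show "12 < wdeg weight lm_u123" by (simp add: lm_u123_def wdeg_add weight_def)
qed simp

lemma leading_u_disc: "wdeg.leading weight (subst (shear 1) (u_disc :: 'k::field_char_0 polyA)) lm_u_disc 1"
proof (rule leadingI)
  \<comment> \<open>The shear fixes \<open>pf_b\<close>, since the two terms \<open>x24 x34\<close>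
    it creates cancel; \<open>?b\<close> is \<open>pf_b\<close> without \<open>x14 y23\<close>,
    whose square leads.\<close>
  let ?b = "vx P12 * vy P34 - vx P13 * vy P24 + vx P34 * vy P12 - vx P24 * vy P13 + vx P23 * vy P14 :: 'k polyA"
  let ?R = "2 * (vx P14 * vy P23) * ?b + ?b * ?b - 4 * (vx P12 * vx P34 - vx P13 * vx P24 + vx P14 * vx P23)
     * ((vy P12 + vx P24) * vy P34 - (vy P13 + vx P34) * vy P24 + vy P14 * vy P23) :: 'k polyA"
  have "Poly_Mapping.single lm_u_disc 1 = (vx P14 * (vy P23 * (vx P14 * vy P23)) :: 'k polyA)"
    by (simp add: lm_u_disc_def var_def mult_single)
  then show "subst (shear 1) u_disc = Poly_Mapping.single lm_u_disc 1 + ?R"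
    by (simp add: u_disc_def pf_a_def pf_b_def pf_c_def subst_simps algebra_simps power2_eq_square)
  show "wle weight 15 ?R" by (rule wle_mono, (rule wle_rules)+, simp add: weight_def)
  show "15 < wdeg weight lm_u_disc" by (simp add: lm_u_disc_def wdeg_add weight_def)
qed simp

text \<open>The sign of \<open>- u123\<close> is that of the fourth entry of \<open>diff1\<close>,
  so each element is the differential of a basis vector.\<close>

lemma regular3_ideal_J:
  "regular3 (u134 :: 'k::field_char_0 polyA) (- u123) u_disc"
proof (rule regular3_transfer[where \<sigma> = "shear 1" and \<tau> = "shear (- 1)"])
  show "regular3 (subst (shear 1) u134) (subst (shear 1) (- u123)) (subst (shear 1) (u_disc :: 'k polyA))"
    by (intro wdeg.regular3_if_coprime_leading[OF leading_u134 leading_u123 leading_u_disc]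
        coprime_mono_if_disjoint)
      (auto simp: lm_u134_def lm_u123_def lm_u_disc_def lookup_add lookup_single when_def)
qed (simp_all add: shear_inverse)

section \<open>Complexes of based free modules\<close>

text \<open>A homomorphism of based free modules is stored as the images \<open>P k\<close> of the
  basis vectors; this evaluates it at \<open>v\<close>.\<close>

definition lincomb :: "nat \<Rightarrow> (nat \<Rightarrow> nat \<Rightarrow> 'a) \<Rightarrow> (nat \<Rightarrow> 'a) \<Rightarrow> nat \<Rightarrow> 'a::comm_ring_1" where
  "lincomb n P v = (\<lambda>j. \<Sum>k<n. v k * P k j)"

definition basisv :: "nat \<Rightarrow> nat \<Rightarrow> 'a::comm_ring_1" where
  "basisv k = (\<lambda>j. if j = k then 1 else 0)"

lemma basisv_fmod: "k < rk F i \<Longrightarrow> basisv k \<in> fmod F i"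
  by (simp add: fmod_def basisv_def)

lemma zerov_fmod [simp]: "zerov \<in> fmod F i"
  by (simp add: fmod_def zerov_def)

lemma ddiff_fmod: "ddiff F i v \<in> fmod F (i - 1)"
  by (simp add: ddiff_def fmod_def)

lemma dmult_fmod: "dmult F p q v w \<in> fmod F (p + q)"
  by (simp add: dmult_def fmod_def)

lemma fmod_scale: "v \<in> fmod F i \<Longrightarrow> (\<lambda>k. c * v k) \<in> fmod F i"
  by (simp add: fmod_def)

lemma fmod_add: "v \<in> fmod F i \<Longrightarrow> w \<in> fmod F i \<Longrightarrow> (\<lambda>k. v k + w k) \<in> fmod F i"
  by (simp add: fmod_def)

lemma fmod_diff: "v \<in> fmod F i \<Longrightarrow> w \<in> fmod F i \<Longrightarrow> (\<lambda>k. v k - w k) \<in> fmod F i"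
  by (simp add: fmod_def)

lemma lincomb_fmod: "(\<And>k. k < n \<Longrightarrow> P k \<in> fmod F i) \<Longrightarrow> lincomb n P v \<in> fmod F i"
  by (simp add: fmod_def lincomb_def)

lemma ddiff_scale: "ddiff F i (\<lambda>k. c * v k) = (\<lambda>k. c * ddiff F i v k)"
  by (auto simp: ddiff_def sum_distrib_left algebra_simps)

lemma ddiff_add: "ddiff F i (\<lambda>k. v k + w k) = (\<lambda>k. ddiff F i v k + ddiff F i w k)"
  by (auto simp: ddiff_def distrib_left sum.distrib)

lemma ddiff_diff: "ddiff F i (\<lambda>k. v k - w k) = (\<lambda>k. ddiff F i v k - ddiff F i w k)"
  by (auto simp: ddiff_def right_diff_distrib sum_subtractf)

lemma ddiff_zerov [simp]: "ddiff F i zerov = zerov"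
  by (auto simp: ddiff_def zerov_def)

lemma lincomb_zerov [simp]: "lincomb n P zerov = zerov"
  by (auto simp: lincomb_def zerov_def)

lemma lincomb_basisv: "k < n \<Longrightarrow> lincomb n P (basisv k) = P k"
  by (auto simp: lincomb_def basisv_def if_distrib[of "\<lambda>x. x * _"] cong: if_cong)

lemma lincomb_cong: "(\<And>k. k < n \<Longrightarrow> P k = Q k) \<Longrightarrow> lincomb n P v = lincomb n Q v"
  by (simp add: lincomb_def)

lemma lincomb_lincomb: "lincomb n (\<lambda>k. lincomb m P (C k)) v = lincomb m P (lincomb n C v)"
proof
  fix j
  have "(\<Sum>k<n. v k * (\<Sum>l<m. C k l * P l j)) = (\<Sum>k<n. \<Sum>l<m. v k * C k l * P l j)"
    by (simp add: sum_distrib_left algebra_simps)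
  also have "\<dots> = (\<Sum>l<m. \<Sum>k<n. v k * C k l * P l j)" by (rule sum.swap)
  finally show "lincomb n (\<lambda>k. lincomb m P (C k)) v j = lincomb m P (lincomb n C v) j"
    by (simp add: lincomb_def sum_distrib_right)
qed

lemma ddiff_lincomb: "ddiff F i (lincomb n P v) = lincomb n (\<lambda>k. ddiff F i (P k)) v"
proof
  fix j
  show "ddiff F i (lincomb n P v) j = lincomb n (\<lambda>k. ddiff F i (P k)) v j"
  proof (cases "0 < i \<and> j < rk F (i - 1)")
    case True
    have "(\<Sum>l<rk F i. dmat F i j l * (\<Sum>k<n. v k * P k l))
        = (\<Sum>l<rk F i. \<Sum>k<n. v k * (dmat F i j l * P k l))"
      by (simp add: sum_distrib_left algebra_simps)
    also have "\<dots> = (\<Sum>k<n. \<Sum>l<rk F i. v k * (dmat F i j l * P k l))" by (rule sum.swap)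
    finally show ?thesis using True by (simp add: ddiff_def lincomb_def sum_distrib_left)
  next
    case False
    then show ?thesis by (auto simp: ddiff_def lincomb_def)
  qed
qed

lemma lincomb_basisv_id: "v \<in> fmod F i \<Longrightarrow> lincomb (rk F i) basisv v = v"
proof
  fix j assume v: "v \<in> fmod F i"
  have "(\<Sum>k<rk F i. v k * basisv k j) = (\<Sum>k<rk F i. if k = j then v k else 0)"
    by (intro sum.cong) (auto simp: basisv_def)
  with v show "lincomb (rk F i) basisv v j = v j"
    by (auto simp: lincomb_def fmod_def)
qed

lemma ddiff_eq_lincomb:
  "v \<in> fmod F i \<Longrightarrow> ddiff F i v = lincomb (rk F i) (\<lambda>k. ddiff F i (basisv k)) v"
  by (metis ddiff_lincomb lincomb_basisv_id)

lemma ddiff_basisv: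
  "k < rk F i \<Longrightarrow> ddiff F i (basisv k) j = (if 0 < i \<and> j < rk F (i - 1) then dmat F i j k else 0)"
  by (simp add: ddiff_def basisv_def if_distrib[of "\<lambda>x. _ * x"] cong: if_cong)

lemma cycles_fmod: "v \<in> cycles F i \<Longrightarrow> v \<in> fmod F i"
  by (simp add: cycles_def)

lemma boundaries_fmod: "v \<in> boundaries F i \<Longrightarrow> v \<in> fmod F i"
  using ddiff_fmod[of F "Suc i"] by (auto simp: boundaries_def)

lemma cycles_0: "cycles F 0 = fmod F 0"
  by (auto simp: cycles_def ddiff_def zerov_def)

subsection \<open>The acyclicity lemma\<close>

lemma regular3_divide:
  assumes reg: "regular3 D1 D2 D3"
    and v: "v \<in> fmod F i" and eq: "\<And>k. D2 * v k = D1 * w k"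
  shows "\<exists>p\<in>fmod F i. v = (\<lambda>k. D1 * p k)"
proof -
  have "\<forall>k. \<exists>p. v k = D1 * p" using reg eq unfolding regular3_def by blast
  then obtain p where p: "\<And>k. v k = D1 * p k" by metis
  have "p \<in> fmod F i"
    unfolding fmod_def
  proof (intro CollectI allI impI)
    fix k assume "rk F i \<le> k"
    then have "D1 * p k = 0" using v p by (simp add: fmod_def)
    then show "p k = 0" using reg unfolding regular3_def by blast
  qed
  with p show ?thesis by blast
qed

lemma regular3_cancel:
  assumes "regular3 D1 D2 D3" "(\<lambda>k. D1 * v k) = (\<lambda>k. D1 * w k)"
  shows "v = w"
proof
  fix k
  have "D1 * (v k - w k) = 0" using fun_cong[OF assms(2), of k] by (simp add: right_diff_distrib)
  then show "v k = w k" using assms(1) unfolding regular3_def by fastforce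
qed

text \<open>Exactness descends from degree 3 to 1, using one more regular element each time. If
  \<open>D w\<close> is the differential of \<open>p\<close> for several \<open>D\<close>, cross
  differences such as \<open>D2 p1 - D1 p2\<close> are cycles one degree higher, hence already
  boundaries, and regularity allows \<open>p1\<close>, suitably corrected, to be divided by
  \<open>D1\<close>.\<close>

lemma acyclic_if_regular3_annihilates:
  fixes F :: "'a::comm_ring_1 dgfree"
  assumes reg: "regular3 D1 D2 D3"
    and ann: "\<And>D i w. D \<in> {D1, D2, D3} \<Longrightarrow> 0 < i \<Longrightarrow> w \<in> cycles F i
      \<Longrightarrow> (\<lambda>k. D * w k) \<in> boundaries F i"
    and dd: "\<And>i. boundaries F i \<subseteq> cycles F i"
    and rk: "\<And>i. 3 < i \<Longrightarrow> rk F i = 0"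
    and i: "0 < i"
  shows "cycles F i = boundaries F i"
proof -
  have lift: "\<exists>p\<in>fmod F (Suc i). ddiff F (Suc i) p = (\<lambda>k. D * w k)"
    if "D \<in> {D1, D2, D3}" "0 < i" "w \<in> cycles F i" for D i w
    using ann[OF that] by (auto simp: boundaries_def)
  have zero: "v = zerov" if "v \<in> fmod F i" "3 < i" for v i
    using that rk by (auto simp: fmod_def zerov_def)
  have bd0: "zerov \<in> boundaries F i" for i
    unfolding boundaries_def by (rule image_eqI[of _ _ zerov]) simp_all
  have ex3: "v = zerov" if v: "v \<in> cycles F 3" for v
  proof -
    obtain p where "p \<in> fmod F 4" "ddiff F 4 p = (\<lambda>k. D1 * v k)"
      using lift[OF _ _ v, of D1] by (auto simp: numeral_eq_Suc)
    with zero[of p 4] have "(\<lambda>k. D1 * v k) = zerov" by simp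
    then have "(\<lambda>k. D1 * v k) = (\<lambda>k. D1 * zerov k)" by (simp add: zerov_def)
    then show ?thesis by (rule regular3_cancel[OF reg])
  qed
  have ex3': "v = w" if "v \<in> fmod F 3" "w \<in> fmod F 3" "ddiff F 3 v = ddiff F 3 w" for v w
  proof -
    have "(\<lambda>k. v k - w k) \<in> cycles F 3"
      using that by (simp add: cycles_def fmod_diff ddiff_diff zerov_def)
    from ex3[OF this] show ?thesis by (auto simp: zerov_def fun_eq_iff)
  qed
  have ex2: "\<exists>p\<in>fmod F 3. ddiff F 3 p = w" if w: "w \<in> cycles F 2" for w
  proof -
    obtain p1 where p1: "p1 \<in> fmod F 3" "ddiff F 3 p1 = (\<lambda>k. D1 * w k)"
      using lift[OF _ _ w, of D1] by (auto simp: numeral_eq_Suc)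
    obtain p2 where p2: "p2 \<in> fmod F 3" "ddiff F 3 p2 = (\<lambda>k. D2 * w k)"
      using lift[OF _ _ w, of D2] by (auto simp: numeral_eq_Suc)
    have "(\<lambda>k. D2 * p1 k) = (\<lambda>k. D1 * p2 k)"
      by (rule ex3') (simp_all add: p1 p2 fmod_scale ddiff_scale algebra_simps)
    then have eq: "\<And>k. D2 * p1 k = D1 * p2 k" by (rule fun_cong)
    obtain p where p: "p \<in> fmod F 3" "p1 = (\<lambda>k. D1 * p k)"
      using regular3_divide[OF reg p1(1) eq] by blast
    have "ddiff F 3 p = w"
      using p1(2) unfolding p(2) ddiff_scale by (rule regular3_cancel[OF reg])
    with p(1) show ?thesis by blast
  qed
  have ex1: "\<exists>p\<in>fmod F 2. ddiff F 2 p = w" if w: "w \<in> cycles F 1" for w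
  proof -
    obtain p1 where p1: "p1 \<in> fmod F 2" "ddiff F 2 p1 = (\<lambda>k. D1 * w k)"
      using lift[OF _ _ w, of D1] by (auto simp: numeral_eq_Suc)
    obtain p2 where p2: "p2 \<in> fmod F 2" "ddiff F 2 p2 = (\<lambda>k. D2 * w k)"
      using lift[OF _ _ w, of D2] by (auto simp: numeral_eq_Suc)
    obtain p3 where p3: "p3 \<in> fmod F 2" "ddiff F 2 p3 = (\<lambda>k. D3 * w k)"
      using lift[OF _ _ w, of D3] by (auto simp: numeral_eq_Suc)
    have cyc: "\<exists>q\<in>fmod F 3. ddiff F 3 q = (\<lambda>k. d * p k - e * p' k)"
      if "p \<in> fmod F 2" "p' \<in> fmod F 2" "ddiff F 2 p = (\<lambda>k. e * w k)" "ddiff F 2 p' = (\<lambda>k. d * w k)"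
      for d e p p'
      by (rule ex2) (simp add: that cycles_def fmod_diff fmod_scale ddiff_diff ddiff_scale zerov_def algebra_simps)
    obtain q12 where q12: "q12 \<in> fmod F 3" "ddiff F 3 q12 = (\<lambda>k. D2 * p1 k - D1 * p2 k)"
      using cyc[OF p1(1) p2(1) p1(2) p2(2)] by blast
    obtain q13 where q13: "q13 \<in> fmod F 3" "ddiff F 3 q13 = (\<lambda>k. D3 * p1 k - D1 * p3 k)"
      using cyc[OF p1(1) p3(1) p1(2) p3(2)] by blast
    obtain q23 where q23: "q23 \<in> fmod F 3" "ddiff F 3 q23 = (\<lambda>k. D3 * p2 k - D2 * p3 k)"
      using cyc[OF p2(1) p3(1) p2(2) p3(2)] by blast
    \<comment> \<open>Both sides have the same differential, because the Koszul combination of the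
      cross differences cancels, and the differential on degree 3 is injective.\<close>
    have "(\<lambda>k. D3 * q12 k) = (\<lambda>k. D2 * q13 k - D1 * q23 k)"
      by (rule ex3') (simp_all add: q12 q13 q23 fmod_scale fmod_diff ddiff_scale ddiff_diff algebra_simps)
    then have eq: "D3 * q12 k = D1 * (- q23 k) + D2 * q13 k" for k
      by (auto dest: fun_cong[of _ _ k])
    then have "\<forall>k. \<exists>s t. q12 k = D1 * s + D2 * t"
      using reg unfolding regular3_def by blast
    then obtain s t where st: "\<And>k. q12 k = D1 * s k + D2 * t k" by metis
    \<comment> \<open>The pointwise choice of \<open>s\<close> and \<open>t\<close> is arbitrary
      beyond the rank; cutting it off gives elements of the free module.\<close>
    define s' where "s' = (\<lambda>k. if k < rk F 3 then s k else 0)"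
    define t' where "t' = (\<lambda>k. if k < rk F 3 then t k else 0)"
    have st': "s' \<in> fmod F 3" "t' \<in> fmod F 3" by (auto simp: s'_def t'_def fmod_def)
    have q12': "q12 = (\<lambda>k. D1 * s' k + D2 * t' k)"
      using q12(1) st by (auto simp: s'_def t'_def fmod_def)
    \<comment> \<open>Substituting \<open>q12 = D1 s' + D2 t'\<close> into
      \<open>d q12 = D2 p1 - D1 p2\<close> and regrouping. The correction of \<open>p1\<close> by a
      boundary does not change its differential.\<close>
    have "D2 * (p1 k - ddiff F 3 t' k) = D1 * (p2 k + ddiff F 3 s' k)" for k
      using fun_cong[OF q12(2), of k] unfolding q12' ddiff_add ddiff_scale
      by (simp add: algebra_simps)
    moreover have dt: "ddiff F 3 t' \<in> boundaries F 2"
      using st'(2) by (auto simp: boundaries_def numeral_eq_Suc)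
    ultimately obtain p where p: "p \<in> fmod F 2" "(\<lambda>k. p1 k - ddiff F 3 t' k) = (\<lambda>k. D1 * p k)"
      using regular3_divide[OF reg, of "\<lambda>k. p1 k - ddiff F 3 t' k" F 2 "\<lambda>k. p2 k + ddiff F 3 s' k"]
        fmod_diff[OF p1(1) boundaries_fmod[OF dt]] by blast
    have "ddiff F 2 (ddiff F 3 t') = zerov"
      using dt dd by (auto simp: cycles_def)
    then have "ddiff F 2 (\<lambda>k. D1 * p k) = (\<lambda>k. D1 * w k)"
      unfolding p(2)[symmetric] ddiff_diff p1(2) by (simp add: zerov_def)
    then have "ddiff F 2 p = w"
      unfolding ddiff_scale by (rule regular3_cancel[OF reg])
    with p(1) show ?thesis by blast
  qed
  consider "i = 1" | "i = 2" | "i = 3" | "3 < i" using i by linarith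
  then have "cycles F i \<subseteq> boundaries F i"
  proof cases
    case 1
    with ex1 show ?thesis by (force simp: boundaries_def numeral_eq_Suc)
  next
    case 2
    with ex2 show ?thesis by (force simp: boundaries_def numeral_eq_Suc)
  next
    case 3
    with ex3 bd0 show ?thesis by blast
  next
    case 4
    with zero bd0 cycles_fmod show ?thesis by blast
  qed
  with dd show ?thesis by blast
qed

subsection \<open>Homogeneous components\<close>

lemma mdeg_eq_wdeg: "mdeg = wdeg (\<lambda>_. 1)"
  by (simp add: mdeg_def wdeg_def fun_eq_iff)

lemma mdeg_add: "mdeg (m + n) = mdeg m + mdeg n"
  by (simp add: mdeg_eq_wdeg wdeg_add)

lemma homogeneous_0 [simp]: "homogeneous n 0"
  by (simp add: homogeneous_def)

lemma homogeneous_1: "homogeneous 0 1"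
  by (simp add: homogeneous_def mdeg_def)

lemma homogeneous_add: "homogeneous n p \<Longrightarrow> homogeneous n q \<Longrightarrow> homogeneous n (p + q)"
  using keys_add[of p q] by (auto simp: homogeneous_def)

lemma homogeneous_uminus: "homogeneous n p \<Longrightarrow> homogeneous n (- p)"
  by (simp add: homogeneous_def in_keys_iff)

lemma homogeneous_diff: "homogeneous n p \<Longrightarrow> homogeneous n q \<Longrightarrow> homogeneous n (p - q)"
  using homogeneous_add[of n p "- q"] by (simp add: homogeneous_uminus)

lemma homogeneous_sum: "(\<And>i. i \<in> S \<Longrightarrow> homogeneous n (f i)) \<Longrightarrow> homogeneous n (\<Sum>i\<in>S. f i)"
  by (induction S rule: infinite_finite_induct) (auto intro: homogeneous_add)

lemma homogeneous_mult:
  "homogeneous m p \<Longrightarrow> homogeneous n q \<Longrightarrow> m + n = d \<Longrightarrow> homogeneous d (p * q)"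
  using keys_mult[of p q] by (force simp: homogeneous_def mdeg_add)

lemma homogeneous_numeral_mult: "homogeneous n p \<Longrightarrow> homogeneous n (numeral k * p)"
  by (rule homogeneous_mult[of 0]) (simp_all add: homogeneous_def mdeg_def flip: single_numeral)

lemma homogeneous_var: "homogeneous 1 (var v)"
  by (simp add: homogeneous_def var_def mdeg_def)

text \<open>The degree is an integer, so that \<open>n - d\<close> in \<open>hpart_mult\<close> is
  never truncated; components of negative degree are 0.\<close>

definition hpart :: "int \<Rightarrow> 'k::comm_ring_1 polyA \<Rightarrow> 'k polyA" where
  "hpart n p = (\<Sum>m\<in>{m \<in> Poly_Mapping.keys p. int (mdeg m) = n}. Poly_Mapping.single m (Poly_Mapping.lookup p m))"

lemma lookup_hpart: "Poly_Mapping.lookup (hpart n p) m = (if int (mdeg m) = n then Poly_Mapping.lookup p m else 0)"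
  by (auto simp: hpart_def lookup_sum lookup_single when_def in_keys_iff)

lemma homogeneous_hpart: "homogeneous n (hpart n p)"
  by (auto simp: homogeneous_def in_keys_iff lookup_hpart split: if_splits)

lemma hpart_id: "homogeneous n p \<Longrightarrow> hpart n p = p"
  by (rule poly_mapping_eqI) (auto simp: homogeneous_def lookup_hpart in_keys_iff)

lemma hpart_0 [simp]: "hpart n 0 = 0"
  by (simp add: hpart_def)

lemma hpart_add: "hpart n (p + q) = hpart n p + hpart n q"
  by (rule poly_mapping_eqI) (simp add: lookup_hpart lookup_add)

lemma hpart_sum: "hpart n (\<Sum>i\<in>S. f i) = (\<Sum>i\<in>S. hpart n (f i))"
  by (induction S rule: infinite_finite_induct) (simp_all add: hpart_add)

lemma hpart_single: "hpart n (Poly_Mapping.single m c) = (if int (mdeg m) = n then Poly_Mapping.single m c else 0)"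
  by (rule poly_mapping_eqI) (auto simp: lookup_hpart lookup_single when_def)

lemma hpart_single_mult:
  "hpart n (Poly_Mapping.single m c * q) = Poly_Mapping.single m c * hpart (n - int (mdeg m)) q"
  by (induction q rule: poly_mapping_additive_induct)
    (auto simp: mult_single hpart_single mdeg_add distrib_left hpart_add)

lemma hpart_mult:
  assumes "homogeneous d p"
  shows "hpart n (p * q) = p * hpart (n - d) q"
proof -
  let ?s = "\<lambda>m. Poly_Mapping.single m (Poly_Mapping.lookup p m)"
  have "hpart n (p * q) = hpart n ((\<Sum>m\<in>Poly_Mapping.keys p. ?s m) * q)"
    by (simp add: sum_monomials)
  also have "\<dots> = (\<Sum>m\<in>Poly_Mapping.keys p. ?s m * hpart (n - int (mdeg m)) q)"
    by (simp add: sum_distrib_right hpart_sum hpart_single_mult)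
  also have "\<dots> = (\<Sum>m\<in>Poly_Mapping.keys p. ?s m * hpart (n - d) q)"
    using assms by (intro sum.cong) (auto simp: homogeneous_def)
  also have "\<dots> = p * hpart (n - d) q"
    by (simp add: sum_monomials flip: sum_distrib_right)
  finally show ?thesis .
qed

lemma positive_degree_if_homogeneous: "homogeneous n p \<Longrightarrow> 0 < n \<Longrightarrow> positive_degree p"
  by (auto simp: homogeneous_def positive_degree_def)

lemma const_coeff_if_positive_degree: "positive_degree p \<Longrightarrow> const_coeff p = 0"
  by (auto simp: positive_degree_def const_coeff_def in_keys_iff mdeg_def dest: bspec[of _ _ 0])

lemma homogeneous_const_coeff: "homogeneous n p \<Longrightarrow> const_coeff p \<noteq> 0 \<Longrightarrow> n = 0"
  by (auto simp: homogeneous_def const_coeff_def in_keys_iff mdeg_def dest: bspec[of _ _ 0])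

lemma const_coeff_0 [simp]: "const_coeff 0 = 0"
  by (simp add: const_coeff_def)

lemma const_coeff_diff: "const_coeff (p - q) = const_coeff p - const_coeff q"
  by (simp add: const_coeff_def lookup_minus)

lemma const_coeff_sum: "const_coeff (\<Sum>i\<in>S. f i) = (\<Sum>i\<in>S. const_coeff (f i))"
  by (simp add: const_coeff_def lookup_sum)

subsection \<open>Comparison of graded free resolutions\<close>

definition homogeneous_vec :: "'k::field polyA dgfree \<Rightarrow> nat \<Rightarrow> int \<Rightarrow> (nat \<Rightarrow> 'k polyA) \<Rightarrow> bool" where
  "homogeneous_vec F i n v \<longleftrightarrow> (\<forall>j<rk F i. homogeneous (n - gdeg F i j) (v j))"

lemma exact_resolution: "graded_free_resolution F I \<Longrightarrow> 0 < i \<Longrightarrow> cycles F i = boundaries F i"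
  by (simp add: graded_free_resolution_def)

lemma boundaries_cycles:
  assumes "graded_free_resolution F I"
  shows "boundaries F i \<subseteq> cycles F i"
  using exact_resolution[OF assms, of i] boundaries_fmod[of _ F i] by (cases i) (auto simp: cycles_0)

text \<open>The differential preserves internal degree, so any lift may be replaced by its component
  of degree \<open>n\<close>.\<close>

lemma graded_lift:
  assumes F: "graded_free_resolution F I"
    and v: "v \<in> boundaries F i" "homogeneous_vec F i n v"
  shows "\<exists>w\<in>fmod F (Suc i). homogeneous_vec F (Suc i) n w \<and> ddiff F (Suc i) w = v"
proof -
  obtain w where w: "w \<in> fmod F (Suc i)" "v = ddiff F (Suc i) w"
    using v(1) by (auto simp: boundaries_def)
  define w' where "w' = (\<lambda>k. hpart (n - gdeg F (Suc i) k) (w k))"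
  have w': "w' \<in> fmod F (Suc i)" using w(1) by (simp add: w'_def fmod_def)
  have "homogeneous_vec F (Suc i) n w'"
    by (simp add: homogeneous_vec_def w'_def homogeneous_hpart)
  moreover have "ddiff F (Suc i) w' = v"
  proof
    fix j
    show "ddiff F (Suc i) w' j = v j"
    proof (cases "j < rk F i")
      case True
      have hom: "homogeneous (gdeg F (Suc i) k - gdeg F i j) (dmat F (Suc i) j k)" if "k < rk F (Suc i)" for k
        using F that True unfolding graded_free_resolution_def by (metis diff_Suc_1 zero_less_Suc)
      have "v j = hpart (n - gdeg F i j) (v j)"
        using v(2) True by (simp add: homogeneous_vec_def hpart_id)
      also have "\<dots> = (\<Sum>k<rk F (Suc i). hpart (n - gdeg F i j) (dmat F (Suc i) j k * w k))"
        using True by (simp add: w(2) ddiff_def hpart_sum)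
      also have "\<dots> = (\<Sum>k<rk F (Suc i). dmat F (Suc i) j k * w' k)"
        by (intro sum.cong) (auto simp: hpart_mult[OF hom] w'_def)
      finally show ?thesis using True by (simp add: ddiff_def)
    next
      case False
      then show ?thesis by (simp add: w(2) ddiff_def)
    qed
  qed
  ultimately show ?thesis using w' by blast
qed

definition chain_map ::
  "'a::comm_ring_1 dgfree \<Rightarrow> 'a dgfree \<Rightarrow> (nat \<Rightarrow> nat \<Rightarrow> nat \<Rightarrow> 'a) \<Rightarrow> bool" where
  "chain_map F G P \<longleftrightarrow> (\<forall>i. \<forall>k<rk F i. P i k \<in> fmod G i) \<and>
     (\<forall>i. \<forall>v\<in>fmod F (Suc i). ddiff G (Suc i) (lincomb (rk F (Suc i)) (P (Suc i)) v)
        = lincomb (rk F i) (P i) (ddiff F (Suc i) v))"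

lemma comparison_map:
  fixes F G :: "'k::field polyA dgfree"
  assumes F: "graded_free_resolution F I" and G: "graded_free_resolution G I"
  shows "\<exists>P. chain_map F G P \<and> P 0 0 = unitv \<and>
    (\<forall>i. \<forall>k<rk F i. homogeneous_vec G i (gdeg F i k) (P i k))"
proof -
  have rk0: "rk F 0 = 1" "rk G 0 = 1" "gdeg F 0 0 = 0" "gdeg G 0 0 = 0"
    using F G by (auto simp: graded_free_resolution_def)
  \<comment> \<open>Preservation of boundaries is what the next lift needs. As an invariant it also
    covers degree 0, where boundaries are the ideal rather than all cycles.\<close>
  define A where "A = (\<lambda>i p. (\<forall>k<rk F i. p k \<in> fmod G i \<and> homogeneous_vec G i (gdeg F i k) (p k)) \<and>
      (\<forall>v\<in>boundaries F i. lincomb (rk F i) p v \<in> boundaries G i) \<and> (i = 0 \<longrightarrow> p 0 = unitv))"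
  define B where "B = (\<lambda>i p q. \<forall>v\<in>fmod F (Suc i). ddiff G (Suc i) (lincomb (rk F (Suc i)) q v)
      = lincomb (rk F i) p (ddiff F (Suc i) v))"
  have "\<exists>P. \<forall>i. A i (P i) \<and> B i (P i) (P (Suc i))"
  proof (rule dependent_nat_choice)
    have "lincomb (rk F 0) (\<lambda>_. unitv) v \<in> boundaries G 0" if v: "v \<in> boundaries F 0" for v
    proof -
      have "(\<lambda>v. v 0) ` boundaries F 0 = (\<lambda>v. v 0) ` boundaries G 0"
        using F G by (auto simp: graded_free_resolution_def)
      with v obtain w where w: "w \<in> boundaries G 0" "w 0 = v 0" by force
      have "lincomb (rk F 0) (\<lambda>_. unitv) v = w"
        using w(2) boundaries_fmod[OF w(1)] by (auto simp: lincomb_def unitv_def fmod_def rk0)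
      with w show ?thesis by simp
    qed
    then show "\<exists>p. A 0 p"
      unfolding A_def
      by (intro exI[of _ "\<lambda>_. unitv"]) (auto simp: rk0 unitv_def fmod_def homogeneous_vec_def homogeneous_1)
  next
    fix p i assume A: "A i p"
    have "\<exists>y\<in>fmod G (Suc i). homogeneous_vec G (Suc i) (gdeg F (Suc i) k) y \<and>
        ddiff G (Suc i) y = lincomb (rk F i) p (ddiff F (Suc i) (basisv k))" if k: "k < rk F (Suc i)" for k
    proof (rule graded_lift[OF G])
      show "lincomb (rk F i) p (ddiff F (Suc i) (basisv k)) \<in> boundaries G i"
        using A basisv_fmod[OF k] by (auto simp: A_def boundaries_def)
      show "homogeneous_vec G i (gdeg F (Suc i) k) (lincomb (rk F i) p (ddiff F (Suc i) (basisv k)))"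
        unfolding homogeneous_vec_def lincomb_def
      proof (intro allI impI homogeneous_sum)
        fix l j assume l: "l < rk G i" and j: "j \<in> {..<rk F i}"
        have "homogeneous (gdeg F (Suc i) k - gdeg F i j) (dmat F (Suc i) j k)"
          using F k j unfolding graded_free_resolution_def by (metis diff_Suc_1 zero_less_Suc lessThan_iff)
        moreover have "homogeneous (gdeg F i j - gdeg G i l) (p j l)"
          using A l j by (auto simp: A_def homogeneous_vec_def)
        ultimately show "homogeneous (gdeg F (Suc i) k - gdeg G i l) (ddiff F (Suc i) (basisv k) j * p j l)"
          using j by (intro homogeneous_mult) (auto simp: ddiff_basisv[OF k])
      qed
    qed
    then obtain y where y: "\<And>k. k < rk F (Suc i) \<Longrightarrow> y k \<in> fmod G (Suc i) \<and>
        homogeneous_vec G (Suc i) (gdeg F (Suc i) k) (y k) \<and>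
        ddiff G (Suc i) (y k) = lincomb (rk F i) p (ddiff F (Suc i) (basisv k))" by metis
    have B: "B i p y"
      unfolding B_def
    proof
      fix v assume v: "v \<in> fmod F (Suc i)"
      have "ddiff G (Suc i) (lincomb (rk F (Suc i)) y v)
          = lincomb (rk F (Suc i)) (\<lambda>k. lincomb (rk F i) p (ddiff F (Suc i) (basisv k))) v"
        unfolding ddiff_lincomb by (rule lincomb_cong) (use y in blast)
      also have "\<dots> = lincomb (rk F i) p (ddiff F (Suc i) v)"
        unfolding lincomb_lincomb by (simp flip: ddiff_eq_lincomb[OF v])
      finally show "ddiff G (Suc i) (lincomb (rk F (Suc i)) y v) = lincomb (rk F i) p (ddiff F (Suc i) v)" .
    qed
    have "lincomb (rk F (Suc i)) y v \<in> boundaries G (Suc i)" if "v \<in> boundaries F (Suc i)" for v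
    proof -
      have v: "v \<in> cycles F (Suc i)" using that boundaries_cycles[OF F] by blast
      then have "ddiff G (Suc i) (lincomb (rk F (Suc i)) y v) = zerov"
        using B by (simp add: B_def cycles_def)
      moreover have "lincomb (rk F (Suc i)) y v \<in> fmod G (Suc i)"
        using y by (intro lincomb_fmod) blast
      ultimately show ?thesis
        using exact_resolution[OF G, of "Suc i"] by (auto simp: cycles_def)
    qed
    with y B show "\<exists>q. A (Suc i) q \<and> B i p q" unfolding A_def by (intro exI[of _ y]) auto
  qed
  then obtain P where P: "\<And>i. A i (P i)" "\<And>i. B i (P i) (P (Suc i))" by blast
  have "chain_map F G P" using P by (auto simp: chain_map_def A_def B_def)
  moreover have "P 0 0 = unitv" using P(1)[of 0] by (simp add: A_def)
  ultimately show ?thesis using P(1) by (auto simp: A_def intro!: exI[of _ P])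
qed

lemma chain_map_compose:
  assumes P: "chain_map F G P" and Q: "chain_map G H Q"
  shows "chain_map F H (\<lambda>i k. lincomb (rk G i) (Q i) (P i k))"
  unfolding chain_map_def
proof (intro conjI allI ballI impI)
  fix i k assume "k < rk F i"
  show "lincomb (rk G i) (Q i) (P i k) \<in> fmod H i"
    using Q by (intro lincomb_fmod) (simp add: chain_map_def)
next
  fix i v assume v: "v \<in> fmod F (Suc i)"
  have "lincomb (rk F (Suc i)) (P (Suc i)) v \<in> fmod G (Suc i)"
    using P by (intro lincomb_fmod) (simp add: chain_map_def)
  then show "ddiff H (Suc i) (lincomb (rk F (Suc i)) (\<lambda>k. lincomb (rk G (Suc i)) (Q (Suc i)) (P (Suc i) k)) v)
    = lincomb (rk F i) (\<lambda>k. lincomb (rk G i) (Q i) (P i k)) (ddiff F (Suc i) v)"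
    using P Q v by (simp add: chain_map_def lincomb_lincomb)
qed

lemma lincomb_diff: "lincomb n (\<lambda>k j. P k j - Q k j) v = (\<lambda>j. lincomb n P v j - lincomb n Q v j)"
  by (simp add: lincomb_def right_diff_distrib sum_subtractf)

lemma minimal_ddiff_const_coeff:
  assumes F: "minimal_complex F"
  shows "const_coeff (ddiff F i v j) = 0"
proof (cases "0 < i \<and> j < rk F (i - 1)")
  case True
  have "const_coeff (dmat F i j k) = 0" if "k < rk F i" for k
    using F True that kernel_const_coeff unfolding minimal_complex_def by blast
  then have "(\<Sum>k<rk F i. const_coeff (dmat F i j k) * const_coeff (v k)) = 0"
    by (intro sum.neutral) simp
  with True show ?thesis by (simp add: ddiff_def const_coeff_sum const_coeff_mult)
qed (auto simp: ddiff_def)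

lemma lincomb_add: "lincomb n (\<lambda>k j. P k j + Q k j) v = (\<lambda>j. lincomb n P v j + lincomb n Q v j)"
  by (simp add: lincomb_def distrib_left sum.distrib)

text \<open>The usual homotopy, started with 0. The invariant \<open>S\<close> records it only on
  cycles, where the term involving the differential of the argument vanishes; the next step applies
  it to differentials of basis vectors, which are cycles.\<close>

lemma chain_map_null_homotopic:
  fixes F :: "'k::field polyA dgfree"
  assumes F: "graded_free_resolution F I"
    and T: "chain_map F F T" and T0: "\<And>k. k < rk F 0 \<Longrightarrow> T 0 k = zerov"
  shows "\<exists>H. \<forall>k<rk F (Suc i). \<exists>h. T (Suc i) k =
    (\<lambda>j. lincomb (rk F i) H (ddiff F (Suc i) (basisv k)) j + ddiff F (Suc (Suc i)) h j)"
proof -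
  define S where "S = (\<lambda>i H. (\<forall>k<rk F i. H k \<in> fmod F (Suc i)) \<and>
    (\<forall>v\<in>cycles F i. lincomb (rk F i) (T i) v = ddiff F (Suc i) (lincomb (rk F i) H v)))"
  have step: "\<exists>h\<in>fmod F (Suc (Suc i)). T (Suc i) k =
      (\<lambda>j. lincomb (rk F i) H (ddiff F (Suc i) (basisv k)) j + ddiff F (Suc (Suc i)) h j)"
    if H: "S i H" and k: "k < rk F (Suc i)" for i H k
  proof -
    let ?x = "\<lambda>j. T (Suc i) k j - lincomb (rk F i) H (ddiff F (Suc i) (basisv k)) j"
    have "ddiff F (Suc i) (basisv k) \<in> boundaries F i"
      using basisv_fmod[OF k] by (auto simp: boundaries_def)
    then have c: "ddiff F (Suc i) (basisv k) \<in> cycles F i"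
      using boundaries_cycles[OF F] by blast
    have "ddiff F (Suc i) (T (Suc i) k) = lincomb (rk F i) (T i) (ddiff F (Suc i) (basisv k))"
      using T basisv_fmod[OF k] by (metis chain_map_def lincomb_basisv[OF k])
    also have "\<dots> = ddiff F (Suc i) (lincomb (rk F i) H (ddiff F (Suc i) (basisv k)))"
      using H c by (simp add: S_def)
    finally have "ddiff F (Suc i) ?x = zerov" by (simp add: ddiff_diff zerov_def)
    moreover have "?x \<in> fmod F (Suc i)"
      using T H k by (intro fmod_diff lincomb_fmod) (auto simp: chain_map_def S_def)
    ultimately have "?x \<in> boundaries F (Suc i)"
      using exact_resolution[OF F, of "Suc i"] by (auto simp: cycles_def)
    then obtain h where "h \<in> fmod F (Suc (Suc i))" "?x = ddiff F (Suc (Suc i)) h"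
      by (auto simp: boundaries_def)
    then show ?thesis by (intro bexI[of _ h]) (auto simp: fun_eq_iff algebra_simps)
  qed
  have "\<exists>H. S i H"
  proof (induction i)
    case 0
    have "lincomb (rk F 0) (T 0) v = zerov" "lincomb (rk F 0) (\<lambda>_. zerov) v = zerov" for v
      using T0 by (auto simp: lincomb_def zerov_def)
    then have "S 0 (\<lambda>_. zerov)" by (simp add: S_def)
    then show ?case by blast
  next
    case (Suc i)
    then obtain H where H: "S i H" by blast
    from step[OF H] obtain H' where H': "\<And>k. k < rk F (Suc i) \<Longrightarrow> H' k \<in> fmod F (Suc (Suc i)) \<and>
      T (Suc i) k = (\<lambda>j. lincomb (rk F i) H (ddiff F (Suc i) (basisv k)) j + ddiff F (Suc (Suc i)) (H' k) j)"
      by metis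
    have "lincomb (rk F (Suc i)) (T (Suc i)) v = ddiff F (Suc (Suc i)) (lincomb (rk F (Suc i)) H' v)"
      if v: "v \<in> cycles F (Suc i)" for v
    proof -
      have "lincomb (rk F (Suc i)) (T (Suc i)) v = lincomb (rk F (Suc i))
          (\<lambda>k j. lincomb (rk F i) H (ddiff F (Suc i) (basisv k)) j + ddiff F (Suc (Suc i)) (H' k) j) v"
        using H' by (intro lincomb_cong) blast
      also have "\<dots> = (\<lambda>j. lincomb (rk F i) H (ddiff F (Suc i) v) j
          + ddiff F (Suc (Suc i)) (lincomb (rk F (Suc i)) H' v) j)"
        unfolding lincomb_add lincomb_lincomb ddiff_lincomb ddiff_eq_lincomb[OF cycles_fmod[OF v]] by simp
      also have "\<dots> = ddiff F (Suc (Suc i)) (lincomb (rk F (Suc i)) H' v)"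
      proof -
        have "ddiff F (Suc i) v = zerov" using v by (simp add: cycles_def)
        then show ?thesis by (simp only: lincomb_zerov) (simp add: zerov_def)
      qed
      finally show ?thesis .
    qed
    with H' have "S (Suc i) H'" by (simp add: S_def)
    then show ?case by blast
  qed
  then obtain H where "S i H" by blast
  from step[OF this] show ?thesis by blast
qed

text \<open>Over a minimal resolution, a chain map lifting the identity of the resolved module is homotopic
  to the identity and hence the identity modulo the irrelevant ideal, so that it cannot factor
  through free modules without generators in the right degrees.\<close>

lemma minimal_resolution_gdeg:
  fixes F G :: "'k::field polyA dgfree"
  assumes F: "graded_free_resolution F I" and min: "minimal_complex F"
    and G: "graded_free_resolution G I" and k: "k < rk F i"
  shows "\<exists>l<rk G i. gdeg F i k = gdeg G i l"
proof -
  have rk0: "rk F 0 = 1" "rk G 0 = 1" "gdeg F 0 0 = 0" "gdeg G 0 0 = 0"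
    using F G by (auto simp: graded_free_resolution_def)
  obtain P where P: "chain_map F G P" "P 0 0 = unitv"
    "\<And>i k. k < rk F i \<Longrightarrow> homogeneous_vec G i (gdeg F i k) (P i k)"
    using comparison_map[OF F G] by blast
  obtain Q where Q: "chain_map G F Q" "Q 0 0 = unitv"
    using comparison_map[OF G F] by blast
  show ?thesis
  proof (cases i)
    case 0
    with k show ?thesis by (simp add: rk0)
  next
    case (Suc n)
    define T where "T = (\<lambda>i k j. lincomb (rk G i) (Q i) (P i k) j - basisv k j)"
    have QP: "chain_map F F (\<lambda>i k. lincomb (rk G i) (Q i) (P i k))"
      by (rule chain_map_compose[OF P(1) Q(1)])
    have T: "chain_map F F T"
      unfolding chain_map_def T_def
    proof (intro conjI allI ballI impI)
      fix i k assume "k < rk F i"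
      then show "(\<lambda>j. lincomb (rk G i) (Q i) (P i k) j - basisv k j) \<in> fmod F i"
        using QP by (intro fmod_diff basisv_fmod) (simp_all add: chain_map_def)
    next
      fix i v assume v: "v \<in> fmod F (Suc i)"
      have dv: "ddiff F (Suc i) v \<in> fmod F i" using ddiff_fmod[of F "Suc i" v] by simp
      show "ddiff F (Suc i) (lincomb (rk F (Suc i))
          (\<lambda>k j. lincomb (rk G (Suc i)) (Q (Suc i)) (P (Suc i) k) j - basisv k j) v) =
         lincomb (rk F i) (\<lambda>k j. lincomb (rk G i) (Q i) (P i k) j - basisv k j) (ddiff F (Suc i) v)"
        using QP v by (simp add: lincomb_diff ddiff_diff chain_map_def lincomb_basisv_id[OF v] lincomb_basisv_id[OF dv])
    qed
    have T0: "T 0 k = zerov" if "k < rk F 0" for k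
      using that P(2) Q(2) by (auto simp: T_def rk0 lincomb_def unitv_def basisv_def zerov_def fun_eq_iff)
    obtain H h where h: "T (Suc n) k =
        (\<lambda>j. lincomb (rk F n) H (ddiff F (Suc n) (basisv k)) j + ddiff F (Suc (Suc n)) h j)"
      using chain_map_null_homotopic[OF F T T0, where i = n] k Suc by blast
    \<comment> \<open>By minimality both summands vanish modulo the irrelevant ideal: one is linear
      in a differential, the other is a differential.\<close>
    have "const_coeff (T (Suc n) k k) = 0"
      unfolding h by (simp add: const_coeff_ring_hom(1) minimal_ddiff_const_coeff[OF min] lincomb_def const_coeff_sum const_coeff_mult)
    \<comment> \<open>The diagonal entry of the composite through \<open>G\<close> is 1 modulo the
      irrelevant ideal, so some entry of \<open>P\<close> has a nonzero constant term; being
      homogeneous, it has degree 0.\<close>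
    then have "(\<Sum>l<rk G i. const_coeff (P i k l) * const_coeff (Q i l k)) = 1"
      by (simp add: T_def Suc const_coeff_diff lincomb_def const_coeff_sum const_coeff_mult basisv_def const_coeff_ring_hom(3))
    then obtain l where l: "l < rk G i" "const_coeff (P i k l) * const_coeff (Q i l k) \<noteq> 0"
      by (metis (no_types, lifting) sum.neutral lessThan_iff zero_neq_one)
    then have "const_coeff (P i k l) \<noteq> 0" by auto
    with homogeneous_const_coeff P(3)[OF k] l(1) have "gdeg F i k - gdeg G i l = 0"
      unfolding homogeneous_vec_def by blast
    with l(1) show ?thesis by auto
  qed
qed

subsection \<open>Structure constants of a graded-commutative algebra\<close>

lemma sum3_rotate:
  "(\<Sum>l\<in>A. \<Sum>i\<in>B. \<Sum>j\<in>C. g l i j) = (\<Sum>i\<in>B. \<Sum>j\<in>C. \<Sum>l\<in>A. (g l i j :: 'a::comm_monoid_add))"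
proof -
  have "(\<Sum>l\<in>A. \<Sum>i\<in>B. \<Sum>j\<in>C. g l i j) = (\<Sum>i\<in>B. \<Sum>l\<in>A. \<Sum>j\<in>C. g l i j)" by (rule sum.swap)
  also have "\<dots> = (\<Sum>i\<in>B. \<Sum>j\<in>C. \<Sum>l\<in>A. g l i j)" by (intro sum.cong refl sum.swap)
  finally show ?thesis .
qed

text \<open>This and the next expansions separate structure constants from vector entries, so that
  both sides of an axiom can be compared coefficientwise.\<close>

lemma dmult_trilinear_left:
  assumes "l < rk F (p + q + r)"
  shows "dmult F (p + q) r (dmult F p q a b) c l =
    (\<Sum>i<rk F p. \<Sum>j<rk F q. \<Sum>k<rk F r. (\<Sum>m<rk F (p + q). sc F p q i j m * sc F (p + q) r m k l) * (a i * b j * c k))"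
proof -
  have "dmult F (p + q) r (dmult F p q a b) c l = (\<Sum>m<rk F (p + q). \<Sum>k<rk F r. \<Sum>i<rk F p. \<Sum>j<rk F q.
      sc F p q i j m * sc F (p + q) r m k l * (a i * b j * c k))"
    using assms by (simp add: dmult_def sum_distrib_left sum_distrib_right algebra_simps)
  also have "\<dots> = (\<Sum>m<rk F (p + q). \<Sum>i<rk F p. \<Sum>j<rk F q. \<Sum>k<rk F r.
      sc F p q i j m * sc F (p + q) r m k l * (a i * b j * c k))"
    by (intro sum.cong refl sum3_rotate)
  also have "\<dots> = (\<Sum>i<rk F p. \<Sum>j<rk F q. \<Sum>m<rk F (p + q). \<Sum>k<rk F r.
      sc F p q i j m * sc F (p + q) r m k l * (a i * b j * c k))"
    by (rule sum3_rotate)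
  also have "\<dots> = (\<Sum>i<rk F p. \<Sum>j<rk F q. \<Sum>k<rk F r. \<Sum>m<rk F (p + q).
      sc F p q i j m * sc F (p + q) r m k l * (a i * b j * c k))"
    by (intro sum.cong refl sum.swap)
  finally show ?thesis by (simp add: sum_distrib_right)
qed

lemma dmult_trilinear_right:
  assumes "l < rk F (p + (q + r))"
  shows "dmult F p (q + r) a (dmult F q r b c) l =
    (\<Sum>i<rk F p. \<Sum>j<rk F q. \<Sum>k<rk F r. (\<Sum>m<rk F (q + r). sc F q r j k m * sc F p (q + r) i m l) * (a i * b j * c k))"
proof -
  have "dmult F p (q + r) a (dmult F q r b c) l = (\<Sum>i<rk F p. \<Sum>m<rk F (q + r). \<Sum>j<rk F q. \<Sum>k<rk F r.
      sc F q r j k m * sc F p (q + r) i m l * (a i * b j * c k))"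
    using assms by (simp add: dmult_def sum_distrib_left sum_distrib_right algebra_simps)
  also have "\<dots> = (\<Sum>i<rk F p. \<Sum>j<rk F q. \<Sum>k<rk F r. \<Sum>m<rk F (q + r).
      sc F q r j k m * sc F p (q + r) i m l * (a i * b j * c k))"
    by (intro sum.cong refl sum3_rotate)
  finally show ?thesis by (simp add: sum_distrib_right)
qed

lemma ddiff_dmult:
  assumes "0 < p + q" "k < rk F (p + q - 1)"
  shows "ddiff F (p + q) (dmult F p q v w) k =
    (\<Sum>i<rk F p. \<Sum>j<rk F q. (\<Sum>l<rk F (p + q). dmat F (p + q) k l * sc F p q i j l) * (v i * w j))"
proof -
  have "ddiff F (p + q) (dmult F p q v w) k = (\<Sum>l<rk F (p + q). \<Sum>i<rk F p. \<Sum>j<rk F q.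
      dmat F (p + q) k l * sc F p q i j l * (v i * w j))"
    using assms by (simp add: ddiff_def dmult_def sum_distrib_left algebra_simps)
  also have "\<dots> = (\<Sum>i<rk F p. \<Sum>j<rk F q. \<Sum>l<rk F (p + q).
      dmat F (p + q) k l * sc F p q i j l * (v i * w j))" by (rule sum3_rotate)
  finally show ?thesis by (simp add: sum_distrib_right)
qed

lemma dmult_ddiff_left:
  assumes "0 < p" "k < rk F (p - 1 + q)"
  shows "dmult F (p - 1) q (ddiff F p v) w k =
    (\<Sum>i<rk F p. \<Sum>j<rk F q. (\<Sum>l<rk F (p - 1). dmat F p l i * sc F (p - 1) q l j k) * (v i * w j))"
proof -
  have "dmult F (p - 1) q (ddiff F p v) w k = (\<Sum>l<rk F (p - 1). \<Sum>j<rk F q. \<Sum>i<rk F p.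
      dmat F p l i * sc F (p - 1) q l j k * (v i * w j))"
    using assms by (simp add: ddiff_def dmult_def sum_distrib_left sum_distrib_right algebra_simps)
  also have "\<dots> = (\<Sum>l<rk F (p - 1). \<Sum>i<rk F p. \<Sum>j<rk F q.
      dmat F p l i * sc F (p - 1) q l j k * (v i * w j))"
    by (intro sum.cong refl sum.swap)
  also have "\<dots> = (\<Sum>i<rk F p. \<Sum>j<rk F q. \<Sum>l<rk F (p - 1).
      dmat F p l i * sc F (p - 1) q l j k * (v i * w j))" by (rule sum3_rotate)
  finally show ?thesis by (simp add: sum_distrib_right)
qed

lemma dmult_ddiff_right:
  assumes "0 < q" "k < rk F (p + (q - 1))"
  shows "dmult F p (q - 1) v (ddiff F q w) k =
    (\<Sum>i<rk F p. \<Sum>j<rk F q. (\<Sum>l<rk F (q - 1). dmat F q l j * sc F p (q - 1) i l k) * (v i * w j))"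
proof -
  have "dmult F p (q - 1) v (ddiff F q w) k = (\<Sum>i<rk F p. \<Sum>l<rk F (q - 1). \<Sum>j<rk F q.
      dmat F q l j * sc F p (q - 1) i l k * (v i * w j))"
    using assms by (simp add: ddiff_def dmult_def sum_distrib_left sum_distrib_right algebra_simps)
  also have "\<dots> = (\<Sum>i<rk F p. \<Sum>j<rk F q. \<Sum>l<rk F (q - 1).
      dmat F q l j * sc F p (q - 1) i l k * (v i * w j))" by (intro sum.cong refl sum.swap)
  finally show ?thesis by (simp add: sum_distrib_right)
qed

lemma ddiff_0 [simp]: "ddiff F 0 v = zerov"
  by (simp add: ddiff_def zerov_def)

lemma dmult_zerov [simp]: "dmult F p q zerov w = zerov" "dmult F p q v zerov = zerov"
  by (auto simp: dmult_def zerov_def)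

lemma zerov_apply [simp]: "zerov k = 0"
  by (simp add: zerov_def)

lemma dmult_outside: "rk F (p + q) \<le> k \<Longrightarrow> dmult F p q v w k = 0"
  by (simp add: dmult_def)

text \<open>The Leibniz rule on basis elements. The conditionals replace \<open>p - 1\<close> and
  \<open>q - 1\<close> at 0, where truncation would yield a wrong module instead of a zero
  differential.\<close>

definition leibniz_coeffs :: "'a::comm_ring_1 dgfree \<Rightarrow> nat \<Rightarrow> nat \<Rightarrow> bool" where
  "leibniz_coeffs F p q \<longleftrightarrow> (\<forall>i<rk F p. \<forall>j<rk F q. \<forall>k<rk F (p + q - 1).
     (\<Sum>l<rk F (p + q). dmat F (p + q) k l * sc F p q i j l) =
     (if p = 0 then 0 else \<Sum>l<rk F (p - 1). dmat F p l i * sc F (p - 1) q l j k)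
     + (- 1) ^ p * (if q = 0 then 0 else \<Sum>l<rk F (q - 1). dmat F q l j * sc F p (q - 1) i l k))"

lemma leibniz_if_coeffs:
  assumes "0 < p + q \<Longrightarrow> leibniz_coeffs F p q"
  shows "ddiff F (p + q) (dmult F p q v w) k =
    dmult F (p - 1) q (ddiff F p v) w k + (- 1) ^ p * dmult F p (q - 1) v (ddiff F q w) k"
proof (cases "0 < p + q \<and> k < rk F (p + q - 1)")
  case True
  define A where "A = (\<lambda>i j. if p = 0 then 0 else \<Sum>l<rk F (p - 1). dmat F p l i * sc F (p - 1) q l j k)"
  define B where "B = (\<lambda>i j. if q = 0 then 0 else \<Sum>l<rk F (q - 1). dmat F q l j * sc F p (q - 1) i l k)"
  have 1: "dmult F (p - 1) q (ddiff F p v) w k = (\<Sum>i<rk F p. \<Sum>j<rk F q. A i j * (v i * w j))"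
    using True dmult_ddiff_left[of p k F q v w] by (cases p) (simp_all add: A_def)
  have 2: "dmult F p (q - 1) v (ddiff F q w) k = (\<Sum>i<rk F p. \<Sum>j<rk F q. B i j * (v i * w j))"
    using True dmult_ddiff_right[of q k F p v w] by (cases q) (simp_all add: B_def)
  have "ddiff F (p + q) (dmult F p q v w) k
      = (\<Sum>i<rk F p. \<Sum>j<rk F q. (A i j + (- 1) ^ p * B i j) * (v i * w j))"
    using True assms ddiff_dmult[of p q k F v w]
    by (auto simp: leibniz_coeffs_def A_def B_def intro!: sum.cong)
  then show ?thesis
    unfolding 1 2 by (simp add: sum_distrib_left distrib_right sum.distrib mult.assoc)
next
  case False
  then have "ddiff F (p + q) (dmult F p q v w) k = 0" by (auto simp: ddiff_def)
  moreover have "dmult F (p - 1) q (ddiff F p v) w k = 0"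
    using False by (cases p) (auto intro: dmult_outside)
  moreover have "dmult F p (q - 1) v (ddiff F q w) k = 0"
    using False by (cases q) (auto intro: dmult_outside)
  ultimately show ?thesis by simp
qed

text \<open>Multilinearity reduces the axioms to identities between structure constants, the form in
  which they can be computed.\<close>

lemma graded_dgaI:
  fixes F :: "'k::field polyA dgfree"
  assumes "\<And>p q i j k. i < rk F p \<Longrightarrow> j < rk F q \<Longrightarrow> k < rk F (p + q) \<Longrightarrow>
      homogeneous (gdeg F p i + gdeg F q j - gdeg F (p + q) k) (sc F p q i j k)"
    and rk0: "rk F 0 = 1"
    and unit: "\<And>q j k. j < rk F q \<Longrightarrow> k < rk F q \<Longrightarrow> sc F 0 q 0 j k = (if k = j then 1 else 0)"
    and comm: "\<And>p q i j k. i < rk F p \<Longrightarrow> j < rk F q \<Longrightarrow> k < rk F (p + q) \<Longrightarrow>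
      sc F p q i j k = (- 1) ^ (p * q) * sc F q p j i k"
    and assoc: "\<And>p q r i j k l. i < rk F p \<Longrightarrow> j < rk F q \<Longrightarrow> k < rk F r \<Longrightarrow> l < rk F (p + q + r) \<Longrightarrow>
      (\<Sum>m<rk F (p + q). sc F p q i j m * sc F (p + q) r m k l)
      = (\<Sum>m<rk F (q + r). sc F q r j k m * sc F p (q + r) i m l)"
    and leib: "\<And>p q. 0 < p + q \<Longrightarrow> leibniz_coeffs F p q"
  shows "graded_dga F"
  unfolding graded_dga_def
proof (intro conjI allI ballI impI)
  show "dmult F 0 q unitv w = w" if w: "w \<in> fmod F q" for q w
  proof
    fix k
    have "(\<Sum>j<rk F q. sc F 0 q 0 j k * w j) = (\<Sum>j<rk F q. if j = k then w j else 0)" if "k < rk F q"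
      using unit that by (intro sum.cong) auto
    with w show "dmult F 0 q unitv w k = w k"
      by (auto simp: dmult_def rk0 unitv_def fmod_def)
  qed
  show "dmult F p q v w k = (- 1) ^ (p * q) * dmult F q p w v k" for p q v w k
  proof (cases "k < rk F (p + q)")
    case True
    have "dmult F p q v w k = (\<Sum>i<rk F p. \<Sum>j<rk F q. (- 1) ^ (p * q) * (sc F q p j i k * w j * v i))"
      using True comm[of _ p _ q k] by (auto simp: dmult_def algebra_simps intro!: sum.cong)
    also have "\<dots> = (\<Sum>j<rk F q. \<Sum>i<rk F p. (- 1) ^ (p * q) * (sc F q p j i k * w j * v i))"
      by (rule sum.swap)
    finally show ?thesis using True by (simp add: dmult_def sum_distrib_left add.commute)
  next
    case False
    then show ?thesis by (simp add: dmult_def add.commute)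
  qed
  show "dmult F (p + q) r (dmult F p q a b) c = dmult F p (q + r) a (dmult F q r b c)" for p q r a b c
  proof
    fix l
    show "dmult F (p + q) r (dmult F p q a b) c l = dmult F p (q + r) a (dmult F q r b c) l"
    proof (cases "l < rk F (p + q + r)")
      case True
      then show ?thesis
        using assoc by (auto simp: dmult_trilinear_left dmult_trilinear_right add.assoc intro!: sum.cong)
    next
      case False
      then show ?thesis by (simp add: dmult_outside add.assoc)
    qed
  qed
  show "ddiff F (p + q) (dmult F p q v w) k =
    dmult F (p - 1) q (ddiff F p v) w k + (- 1) ^ p * dmult F p (q - 1) v (ddiff F q w) k" for p q v w k
    using leib by (rule leibniz_if_coeffs)
qed (use assms(1) in blast)

section \<open>The resolution\<close>

text \<open>With \<open>U = (u234, u134, u124, - u123)\<close>, one has \<open>U = M Z\<close> for the vector \<open>Z\<close> and the matrix \<open>M\<close>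
  below, and \<open>M\<^sup>2 = u_disc I\<close>.  For the skew-symmetric matrices \<open>X\<close>, \<open>Y\<close> of the \<open>x\<close> and \<open>y\<close> variables,
  \<open>X\<^sup>T M\<close> and \<open>Y\<^sup>T M\<close> are skew-symmetric.  This gives the relations \<open>M U - u_disc Z = 0\<close>,
  \<open>(X Z)\<^sup>T U = 0\<close>, \<open>(Y Z)\<^sup>T U = 0\<close>, which are the columns of \<open>diff2\<close> in this order.  The columns of
  \<open>diff3\<close> express \<open>M\<^sup>T X = 2 a Y - b X\<close> and \<open>M\<^sup>T Y = b Y - 2 c X\<close>.\<close>

definition vec_Z :: "nat \<Rightarrow> 'k::comm_ring_1 polyA" where
  "vec_Z i = [vz T234, vz T134, vz T124, vz T123] ! i"

definition mat_M :: "nat \<Rightarrow> nat \<Rightarrow> 'k::comm_ring_1 polyA" where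
  "mat_M i j = [[- delta1 + delta2 - delta3, - 2 * Delta P23 P24, 2 * Delta P23 P34, - 2 * Delta P24 P34],
     [2 * Delta P13 P14, - delta1 - delta2 + delta3, 2 * Delta P13 P34, - 2 * Delta P14 P34],
     [2 * Delta P12 P14, - 2 * Delta P12 P24, delta1 + delta2 + delta3, - 2 * Delta P14 P24],
     [2 * Delta P12 P13, - 2 * Delta P12 P23, 2 * Delta P13 P23, delta1 - delta2 - delta3]] ! i ! j"

text \<open>This is the plain skew-symmetric matrix conjugated by diag(1, -1, 1, -1) and negated;
  its Pfaffian is unchanged.\<close>

definition skew :: "(pair4 \<Rightarrow> 'a::comm_ring_1) \<Rightarrow> nat \<Rightarrow> nat \<Rightarrow> 'a" where
  "skew f i j = [[0, f P12, - f P13, f P14], [- f P12, 0, f P23, - f P24],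
     [f P13, - f P23, 0, f P34], [- f P14, f P24, - f P34, 0]] ! i ! j"

text \<open>The Pfaffian dual: its product with \<open>skew f\<close> is minus the Pfaffian times
  the identity. The Pfaffian is \<open>pf_a\<close> for the x and \<open>pf_c\<close> for the y
  variables.\<close>

definition skew_dual :: "(pair4 \<Rightarrow> 'a::comm_ring_1) \<Rightarrow> nat \<Rightarrow> nat \<Rightarrow> 'a" where
  "skew_dual f i j = [[0, f P34, f P24, f P23], [- f P34, 0, f P14, f P13],
     [- f P24, - f P14, 0, f P12], [- f P23, - f P13, - f P12, 0]] ! i ! j"

definition skewZ :: "(pair4 \<Rightarrow> 'k::comm_ring_1 polyA) \<Rightarrow> nat \<Rightarrow> 'k polyA" where
  "skewZ f i = (\<Sum>j<4. skew f i j * vec_Z j)"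

definition diff1 :: "nat \<Rightarrow> 'k::comm_ring_1 polyA" where
  "diff1 i = [u234, u134, u124, - u123, u_disc] ! i"

definition diff2 :: "nat \<Rightarrow> nat \<Rightarrow> 'k::comm_ring_1 polyA" where
  "diff2 j k = (if k < 4 then if j < 4 then mat_M k j else - vec_Z k
     else if j < 4 then skewZ (if k = 4 then vx else vy) j else 0)"

definition diff3 :: "nat \<Rightarrow> nat \<Rightarrow> 'k::comm_ring_1 polyA" where
  "diff3 j k = (if j < 4 then skewZ (if k = 0 then vx else vy) j
     else [[pf_b, 2 * pf_c], [- 2 * pf_a, - pf_b]] ! (j - 4) ! k)"

text \<open>Writing e, f for the bases of degrees 1 and 2, a product of e_i and e_4 must have
  differential U_i e_4 - u_disc e_i. The choice - sum M_ik f_k works because M^2 = u_disc I and M Z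
  = U. Products of two cubic generators combine Z with the duals of X and Y.\<close>

definition mult11 :: "nat \<Rightarrow> nat \<Rightarrow> nat \<Rightarrow> 'k::comm_ring_1 polyA" where
  "mult11 i j k = (if i < 4 \<and> j < 4 then
       if k < 4 then (if k = i then vec_Z j else 0) - (if k = j then vec_Z i else 0)
       else if k = 4 then 2 * skew_dual vy i j else - 2 * skew_dual vx i j
     else if i < 4 \<and> k < 4 then - mat_M i k
     else if j < 4 \<and> k < 4 then mat_M j k
     else 0)"

text \<open>The 2 by 2 block is the transpose of the lower block of \<open>diff3\<close>, a matrix
  of trace 0 and determinant - u_disc, which therefore squares to u_disc I.\<close>

definition mult12 :: "nat \<Rightarrow> nat \<Rightarrow> nat \<Rightarrow> 'k::comm_ring_1 polyA" where
  "mult12 i j k = (if i < 4 then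
       if j < 4 then if k = 0 then 2 * skew_dual vy i j else - 2 * skew_dual vx i j
       else if j = k + 4 then vec_Z i else 0
     else if j < 4 then 0
     else [[pf_b, - 2 * pf_a], [2 * pf_c, - pf_b]] ! (j - 4) ! k)"

lemma less_nat_cases:
  "(i::nat) < 2 \<longleftrightarrow> i = 0 \<or> i = 1"
  "(i::nat) < 4 \<longleftrightarrow> i = 0 \<or> i = 1 \<or> i = 2 \<or> i = 3"
  "(i::nat) < 5 \<longleftrightarrow> i = 0 \<or> i = 1 \<or> i = 2 \<or> i = 3 \<or> i = 4"
  "(i::nat) < 6 \<longleftrightarrow> i = 0 \<or> i = 1 \<or> i = 2 \<or> i = 3 \<or> i = 4 \<or> i = 5"
  by auto

lemma sum_less_numeral:
  "(\<Sum>k<2. f k) = f 0 + f (1::nat)"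
  "(\<Sum>k<4. f k) = f 0 + f 1 + f 2 + f 3"
  "(\<Sum>k<5. f k) = f 0 + f 1 + f 2 + f 3 + f 4"
  "(\<Sum>k<6. f k) = f 0 + f 1 + f 2 + f 3 + f 4 + (f 5 :: 'a::comm_ring_1)"
  by (simp_all add: eval_nat_numeral lessThan_Suc algebra_simps)

text \<open>Kept apart from \<open>poly_defs\<close>: entries are selected and zero products removed
  before the polynomials are expanded.\<close>

lemmas vector_defs = vec_Z_def mat_M_def skew_def skew_dual_def skewZ_def diff1_def diff2_def diff3_def mult11_def mult12_def
  sum_less_numeral

lemmas poly_defs = delta1_def delta2_def delta3_def Delta_def u123_def u124_def u134_def u234_def
  u_disc_def pf_a_def pf_b_def pf_c_def power2_eq_square

section \<open>Polynomial identities behind the differentials and products\<close>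

lemma mat_M_vec_Z: "i < 4 \<Longrightarrow> (\<Sum>j<4. mat_M i j * vec_Z j) = (diff1 i :: 'k::comm_ring_1 polyA)"
  unfolding less_nat_cases
  by (elim disjE; simp add: vector_defs; simp add: poly_defs algebra_simps)

text \<open>Checked by expansion. Conceptually, P = X' Y satisfies P^2 + b P + a c I = 0 for the
  Pfaffian dual X' of X, and M = - (2 P + b I), so M^2 is the discriminant.\<close>

lemma mat_M_squared:
  assumes "i < 4" "j < 4"
  shows "(\<Sum>k<4. mat_M i k * mat_M k j) = (if i = j then u_disc else 0 :: 'k::comm_ring_1 polyA)"
  using assms unfolding less_nat_cases
  by (elim disjE; simp add: vector_defs; simp add: poly_defs algebra_simps)

text \<open>The first four columns follow from M U = M^2 Z, which spares expanding quintics. For the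
  last two, Z^T X^T M Z and Z^T Y^T M Z vanish as X^T M and Y^T M are skew-symmetric.\<close>

lemma diff1_diff2:
  assumes "k < 6"
  shows "(\<Sum>j<5. diff1 j * diff2 j k) = (0 :: 'k::comm_ring_1 polyA)"
proof (cases "k < 4")
  case True
  have "(\<Sum>j<4. mat_M k j * diff1 j) = (\<Sum>j<4. mat_M k j * (\<Sum>l<4. mat_M j l * vec_Z l) :: 'k polyA)"
    by (simp add: mat_M_vec_Z)
  also have "\<dots> = (\<Sum>j<4. \<Sum>l<4. mat_M k j * mat_M j l * vec_Z l)"
    by (simp add: sum_distrib_left mult.assoc)
  also have "\<dots> = (\<Sum>l<4. (\<Sum>j<4. mat_M k j * mat_M j l) * vec_Z l)"
    unfolding sum_distrib_right by (rule sum.swap)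
  also have "\<dots> = (\<Sum>l<4. if l = k then u_disc * vec_Z l else 0)"
    using True by (intro sum.cong) (auto simp: mat_M_squared)
  finally have "(\<Sum>j<4. mat_M k j * diff1 j) = u_disc * (vec_Z k :: 'k polyA)"
    using True by simp
  moreover have "(\<Sum>j<5. diff1 j * diff2 j k) = (\<Sum>j<4. mat_M k j * diff1 j) - u_disc * (vec_Z k :: 'k polyA)"
    using True by (simp add: sum_less_numeral diff2_def) (simp add: diff1_def algebra_simps)
  ultimately show ?thesis by simp
next
  case False
  with assms have "k = 4 \<or> k = 5" by linarith
  then show ?thesis
    by (elim disjE; simp add: vector_defs; simp add: poly_defs algebra_simps)
qed

text \<open>The last row gives - Z^T X Z and - Z^T Y Z, zero by skew-symmetry; the others are the
  matrix identities recorded in \<open>diff3\<close>, applied to Z.\<close>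

lemma diff2_diff3:
  assumes "j < 5" "k < 2"
  shows "(\<Sum>l<6. diff2 j l * diff3 l k) = (0 :: 'k::comm_ring_1 polyA)"
  using assms unfolding less_nat_cases
  by (elim disjE; simp add: vector_defs; simp add: poly_defs algebra_simps)

lemma leibniz_mult11_cubic:
  assumes "i < 4" "j < 4" "l < 5"
  shows "(\<Sum>k<6. diff2 l k * mult11 i j k) = ((if j = l then diff1 i else 0) - (if i = l then diff1 j else 0) :: 'k::comm_ring_1 polyA)"
  using assms unfolding less_nat_cases
  by (elim disjE; simp add: vector_defs; simp add: poly_defs algebra_simps)

lemma leibniz_mult12_first:
  assumes "i < 4" "k < 6" "l < 6"
  shows "(\<Sum>h<2. diff3 l h * mult12 i k h) = ((if k = l then diff1 i else 0) - (\<Sum>j<5. diff2 j k * mult11 i j l) :: 'k::comm_ring_1 polyA)"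
  using assms unfolding less_nat_cases
  by (elim disjE; simp add: vector_defs; simp add: poly_defs algebra_simps)

lemma leibniz_mult12_last:
  assumes "k \<in> {4,5}" "l < 6"
  shows "(\<Sum>h<2. diff3 l h * mult12 4 k h) = ((if k = l then u_disc else 0) - (\<Sum>j<5. diff2 j k * mult11 4 j l) :: 'k::comm_ring_1 polyA)"
  using assms unfolding less_nat_cases
  by (elim disjE insertE; simp add: vector_defs; simp add: poly_defs algebra_simps)

subsection \<open>Verification\<close>

text \<open>The product of degrees 2 and 1 is \<open>mult12\<close> with its arguments exchanged;
  the graded sign is + 1 because 2 * 1 is even.\<close>

definition resolution_J :: "'k::comm_ring_1 polyA dgfree" where
  "resolution_J = \<lparr>rk = (\<lambda>i. if i < 4 then [1, 5, 6, 2] ! i else 0),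
     gdeg = (\<lambda>i k. if i = 0 then 0 else if i = 1 then (if k < 4 then 3 else 4) else if i = 2 then 5 else 7),
     dmat = (\<lambda>i j k. if i = 1 then diff1 k else if i = 2 then diff2 j k else diff3 j k),
     sc = (\<lambda>p q i j k. if p = 0 then (if k = j then 1 else 0) else if q = 0 then (if k = i then 1 else 0)
       else if p = 1 \<and> q = 1 then mult11 i j k else if p = 1 \<and> q = 2 then mult12 i j k
       else if p = 2 \<and> q = 1 then mult12 j i k else 0)\<rparr>"

lemma rk_resolution_J:
  "rk resolution_J 0 = 1" "rk resolution_J (Suc 0) = 5" "rk resolution_J 2 = 6" "rk resolution_J 3 = 2" "3 < i \<Longrightarrow> rk resolution_J i = 0"
  by (simp_all add: resolution_J_def)

lemma rk_resolution_J_pos: "j < rk resolution_J i \<Longrightarrow> i \<le> 3"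
  by (rule ccontr) (simp add: rk_resolution_J)

section \<open>Internal degrees of the matrix entries and products\<close>

lemma homogeneous_scale: "homogeneous n p \<Longrightarrow> homogeneous n (- numeral k * p)"
  using homogeneous_uminus[OF homogeneous_numeral_mult[of n p k]] by simp

lemma homogeneous_Delta: "homogeneous 2 (Delta p q)"
  unfolding Delta_def
  by (intro homogeneous_diff homogeneous_mult[OF homogeneous_var homogeneous_var]) simp_all

lemma homogeneous_pf: "homogeneous 2 pf_a" "homogeneous 2 pf_b" "homogeneous 2 pf_c"
  unfolding pf_a_def pf_b_def pf_c_def
  by (intro homogeneous_add homogeneous_diff homogeneous_mult[OF homogeneous_var homogeneous_var]; simp)+

lemma homogeneous_vec_Z: "i < 4 \<Longrightarrow> homogeneous 1 (vec_Z i)"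
  unfolding less_nat_cases by (auto simp: vec_Z_def homogeneous_var)

lemma homogeneous_skew:
  assumes "\<And>p. homogeneous n (f p)" "i < 4" "j < 4"
  shows "homogeneous n (skew f i j)" "homogeneous n (skew_dual f i j)"
  using assms(2,3) unfolding less_nat_cases
  by (elim disjE; simp add: skew_def skew_dual_def assms(1) homogeneous_uminus)+

lemma homogeneous_mat_M: "i < 4 \<Longrightarrow> j < 4 \<Longrightarrow> homogeneous 2 (mat_M i j)"
  unfolding less_nat_cases
  by (elim disjE; simp add: mat_M_def delta1_def delta2_def delta3_def)
    (intro homogeneous_add homogeneous_diff homogeneous_uminus homogeneous_scale homogeneous_numeral_mult homogeneous_Delta)+

lemma homogeneous_skewZ:
  assumes "\<And>p. homogeneous 1 (f p)" "i < 4"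
  shows "homogeneous 2 (skewZ f i)"
  unfolding skewZ_def using assms
  by (intro homogeneous_sum homogeneous_mult[of 1 _ 1] homogeneous_skew homogeneous_vec_Z) auto

lemma homogeneous_diff1: "i < 5 \<Longrightarrow> homogeneous (if i < 4 then 3 else 4) (diff1 i)"
proof (cases "i < 4")
  case True
  then have "homogeneous 3 (\<Sum>j<4. mat_M i j * vec_Z j)"
    by (intro homogeneous_sum homogeneous_mult[of 2 _ 1] homogeneous_mat_M homogeneous_vec_Z) auto
  with True show ?thesis by (simp add: mat_M_vec_Z)
next
  case False
  assume "i < 5"
  with False have "i = 4" by simp
  moreover have "homogeneous 4 u_disc"
    unfolding u_disc_def power2_eq_square
    by (intro homogeneous_diff homogeneous_mult[of 2 _ 2] homogeneous_numeral_mult homogeneous_pf) simp_all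
  ultimately show ?thesis by (simp add: diff1_def)
qed

lemma homogeneous_diff2: "j < 5 \<Longrightarrow> k < 6 \<Longrightarrow> homogeneous (if j < 4 then 2 else 1) (diff2 j k)"
  by (auto simp: diff2_def intro: homogeneous_mat_M homogeneous_skewZ homogeneous_var homogeneous_uminus homogeneous_vec_Z)

lemma homogeneous_diff3: "j < 6 \<Longrightarrow> k < 2 \<Longrightarrow> homogeneous 2 (diff3 j k)"
  unfolding less_nat_cases
  by (elim disjE; simp add: diff3_def homogeneous_skewZ homogeneous_var homogeneous_pf homogeneous_uminus homogeneous_numeral_mult)

lemma homogeneous_mult11:
  assumes "i < 5" "j < 5" "k < 6"
  shows "homogeneous ((if i < 4 then 3 else 4) + (if j < 4 then 3 else 4) - 5) (mult11 i j k)"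
proof -
  have "homogeneous 1 (2 * skew_dual vy i j)" "homogeneous 1 (- 2 * skew_dual vx i j)" if "i < 4" "j < 4" 
    using that by (intro homogeneous_scale homogeneous_numeral_mult homogeneous_skew homogeneous_var; simp)+
  moreover consider "i < 4" "j < 4" | "i < 4" "j = 4" | "i = 4" "j < 4" | "i = 4" "j = 4"
    using assms by linarith
  ultimately show ?thesis
    by cases (auto simp: mult11_def intro: homogeneous_vec_Z homogeneous_mat_M homogeneous_uminus homogeneous_diff)
qed

lemma homogeneous_mult12:
  assumes "i < 5" "j < 6" "k < 2"
  shows "homogeneous (if i < 4 then 1 else 2) (mult12 i j k)"
proof -
  have "homogeneous 1 (2 * skew_dual vy i j)" "homogeneous 1 (- 2 * skew_dual vx i j)" if "i < 4" "j < 4" 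
    using that by (intro homogeneous_scale homogeneous_numeral_mult homogeneous_skew homogeneous_var; simp)+
  moreover have "homogeneous 2 ([[pf_b, - 2 * pf_a], [2 * pf_c, - pf_b]] ! (j - 4) ! k)" if "4 \<le> j"
  proof -
    have "j - 4 = 0 \<or> j - 4 = 1" "k = 0 \<or> k = 1" using assms that by linarith+
    then show ?thesis
      by (elim disjE) (simp_all add: homogeneous_pf homogeneous_uminus homogeneous_numeral_mult)
  qed
  ultimately show ?thesis using assms by (auto simp: mult12_def intro: homogeneous_vec_Z)
qed

section \<open>Commutativity, associativity and the Leibniz rule\<close>

lemma skew_dual_antisym: "i < 4 \<Longrightarrow> j < 4 \<Longrightarrow> skew_dual f j i = - skew_dual f i j"
  unfolding less_nat_cases by (elim disjE; simp add: skew_dual_def)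

lemma mult11_antisym: "i < 5 \<Longrightarrow> j < 5 \<Longrightarrow> mult11 j i k = - mult11 i j k"
  by (auto simp: mult11_def skew_dual_antisym[of i j])

text \<open>The only associativity instance without a unit, since three positive degrees must sum to
  3. The left side uses that an element of degree 2 commutes with one of degree 1.\<close>

lemma mult11_mult12_assoc:
  assumes "i < 5" "j < 5" "k < 5" "l < 2"
  shows "(\<Sum>m<6. mult11 i j m * mult12 k m l) = (\<Sum>m<6. mult11 j k m * mult12 i m l :: 'k::comm_ring_1 polyA)"
  using assms unfolding less_nat_cases
  by (elim disjE; simp add: vector_defs; simp add: poly_defs algebra_simps)

lemma leibniz_mult11:
  assumes "i < 5" "j < 5" "l < 5"
  shows "(\<Sum>k<6. diff2 l k * mult11 i j k)
    = ((if j = l then diff1 i else 0) - (if i = l then diff1 j else 0) :: 'k::comm_ring_1 polyA)"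
proof -
  \<comment> \<open>Products with the quartic generator are handled by \<open>mat_M_squared\<close>
    and \<open>mat_M_vec_Z\<close> instead of expansion.\<close>
  have *: "(\<Sum>k<6. diff2 l k * mult11 i 4 k) = (if 4 = l then diff1 i else 0) - (if i = l then u_disc else 0 :: 'k polyA)"
    if i: "i < 4" for i
  proof (cases "l < 4")
    case True
    have "(\<Sum>k<6. diff2 l k * mult11 i 4 k) = - (\<Sum>k<4. mat_M i k * mat_M k l :: 'k polyA)"
      using i True by (simp add: sum_less_numeral mult11_def diff2_def)
    with i True show ?thesis by (simp add: mat_M_squared)
  next
    case False
    with assms have "l = 4" by simp
    have "(\<Sum>k<6. diff2 4 k * mult11 i 4 k) = (\<Sum>k<4. mat_M i k * vec_Z k :: 'k polyA)"
      using i by (simp add: sum_less_numeral mult11_def diff2_def)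
    with i \<open>l = 4\<close> show ?thesis by (simp add: mat_M_vec_Z)
  qed
  consider "i < 4" "j < 4" | "i < 4" "j = 4" | "i = 4" "j < 4" | "i = 4" "j = 4" using assms by linarith
  then show ?thesis
  proof cases
    case 1
    with leibniz_mult11_cubic assms show ?thesis by blast
  next
    case 2
    with * show ?thesis by (simp add: diff1_def)
  next
    case 3
    have "(\<Sum>k<6. diff2 l k * mult11 4 j k) = - (\<Sum>k<6. diff2 l k * mult11 j 4 k :: 'k polyA)"
      using 3 mult11_antisym[of j 4, where 'a = 'k] by (simp add: sum_negf)
    with 3 *[of j] show ?thesis by (simp add: diff1_def)
  next
    case 4
    then show ?thesis by (simp add: sum_less_numeral mult11_def)
  qed
qed

text \<open>For \<open>i = 4\<close> and \<open>k < 4\<close> the product is 0, so the quartic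
  generator times the differential of f_k must be u_disc f_k; this is M^2 = u_disc I again.\<close>

lemma leibniz_mult12:
  assumes "i < 5" "k < 6" "l < 6"
  shows "(\<Sum>h<2. diff3 l h * mult12 i k h)
    = ((if k = l then diff1 i else 0) - (\<Sum>j<5. diff2 j k * mult11 i j l) :: 'k::comm_ring_1 polyA)"
proof -
  consider "i < 4" | "i = 4" "k < 4" | "i = 4" "k \<in> {4, 5}" using assms by force
  then show ?thesis
  proof cases
    case 1
    with leibniz_mult12_first assms show ?thesis by blast
  next
    case 2
    have "(\<Sum>j<5. diff2 j k * mult11 4 j l) = (if l < 4 then \<Sum>j<4. mat_M k j * mat_M j l else 0 :: 'k polyA)"
      using 2 by (simp add: sum_less_numeral mult11_def diff2_def)
    with 2 show ?thesis by (auto simp: sum_less_numeral(1) mult12_def mat_M_squared diff1_def)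
  next
    case 3
    with leibniz_mult12_last[of k l, where 'k = 'k] assms(3) show ?thesis by (simp add: diff1_def)
  qed
qed

text \<open>Products of degrees 1 and 3 land in the zero module of degree 4, so the two terms of the
  Leibniz rule must cancel.\<close>

lemma leibniz_mult12_diff3:
  assumes "i < 5" "k < 2" "h < 2"
  shows "(\<Sum>l<6. diff3 l k * mult12 i l h) = (if k = h then diff1 i else 0 :: 'k::comm_ring_1 polyA)"
  using assms unfolding less_nat_cases
  by (elim disjE; simp add: vector_defs; simp add: poly_defs algebra_simps)

text \<open>The same condition for two elements of degree 2, whose product also lies in degree
  4.\<close>

lemma leibniz_mult12_diff2:
  assumes "k < 6" "l < 6" "h < 2"
  shows "(\<Sum>j<5. diff2 j k * mult12 j l h) + (\<Sum>j<5. diff2 j l * mult12 j k h) = (0 :: 'k::comm_ring_1 polyA)"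
  using assms unfolding less_nat_cases
  by (elim disjE; simp add: vector_defs; simp add: poly_defs algebra_simps)

text \<open>For \<open>p = 0\<close> the first branch compares \<open>k\<close> with
  \<open>j\<close> instead of \<open>i\<close>; the bounds force both indices to be 0.\<close>

lemma sc_resolution_J_unit:
  "sc resolution_J 0 q i j k = (if k = j then 1 else 0)"
  "i < rk (resolution_J :: 'k::comm_ring_1 polyA dgfree) p \<Longrightarrow> j < rk (resolution_J :: 'k polyA dgfree) 0 \<Longrightarrow>
    sc (resolution_J :: 'k polyA dgfree) p 0 i j k = (if k = i then 1 else 0)"
  by (simp add: resolution_J_def, cases p) (simp_all add: resolution_J_def)

lemma sc_resolution_J:
  "sc resolution_J (Suc 0) (Suc 0) = mult11" "sc resolution_J (Suc 0) 2 = mult12" "sc resolution_J 2 (Suc 0) i j k = mult12 j i k"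
  by (simp_all add: resolution_J_def fun_eq_iff)

lemma dmat_resolution_J:
  "dmat resolution_J (Suc 0) i k = diff1 k" "dmat resolution_J 2 = diff2" "dmat resolution_J 3 = diff3"
  by (simp_all add: resolution_J_def fun_eq_iff)

lemma gdeg_resolution_J:
  "gdeg resolution_J 0 k = 0" "gdeg resolution_J (Suc 0) k = (if k < 4 then 3 else 4)" "gdeg resolution_J 2 k = 5" "gdeg resolution_J 3 k = 7"
  by (simp_all add: resolution_J_def)

lemma sum_mult_delta:
  assumes "finite S" "k \<in> S"
  shows "(\<Sum>l\<in>S. f l * (if l = k then 1 else 0)) = (f k :: 'a::comm_ring_1)"
    "(\<Sum>l\<in>S. f l * (if k = l then 1 else 0)) = f k"
    "(\<Sum>l\<in>S. (if l = k then 1 else 0) * f l) = f k"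
    "(\<Sum>l\<in>S. (if k = l then 1 else 0) * f l) = f k"
  using assms by (simp_all add: if_distrib[of "\<lambda>x. _ * x"] if_distrib[of "\<lambda>x. x * _"] cong: if_cong)

lemma positive_nat_le_3_cases: "0 < i \<Longrightarrow> i \<le> 3 \<Longrightarrow> i = Suc 0 \<or> i = 2 \<or> i = (3::nat)"
  by auto

lemma leibniz_resolution_J:
  assumes "0 < p + q"
  shows "leibniz_coeffs (resolution_J :: 'k::comm_ring_1 polyA dgfree) p q"
  unfolding leibniz_coeffs_def
proof (intro allI impI)
  let ?F = "resolution_J :: 'k polyA dgfree"
  fix i j k
  assume i: "i < rk ?F p" and j: "j < rk ?F q" and k: "k < rk ?F (p + q - 1)"
  have le: "p \<le> 3" "q \<le> 3" "p + q - 1 \<le> 3" using i j k rk_resolution_J_pos by blast+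
  \<comment> \<open>The bound is on \<open>p + q - 1\<close>, so products landing in degree 4
    remain; they give the last three cases.\<close>
  consider "p = 0" | "q = 0" "0 < p" | "p = Suc 0" "q = Suc 0" | "p = Suc 0" "q = 2" | "p = 2" "q = Suc 0"
    | "p = Suc 0" "q = 3" | "p = 3" "q = Suc 0" | "p = 2" "q = 2"
    using le by (cases "p = 0"; cases "q = 0") (auto dest!: positive_nat_le_3_cases)
  then show "(\<Sum>l<rk ?F (p + q). dmat ?F (p + q) k l * sc ?F p q i j l) =
     (if p = 0 then 0 else \<Sum>l<rk ?F (p - 1). dmat ?F p l i * sc ?F (p - 1) q l j k)
     + (- 1) ^ p * (if q = 0 then 0 else \<Sum>l<rk ?F (q - 1). dmat ?F q l j * (sc ?F p (q - 1) i l k :: 'k polyA))"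
  proof cases
    case 1
    then show ?thesis using assms i j k by (simp add: sc_resolution_J_unit(1) sum_mult_delta)
  next
    case 2
    then have j: "j < rk ?F 0" using j by simp
    have "(\<Sum>l<rk ?F (p - 1). dmat ?F p l i * sc ?F (p - 1) 0 l j k)
        = (\<Sum>l<rk ?F (p - 1). dmat ?F p l i * (if k = l then 1 else (0 :: 'k polyA)))"
      using j by (intro sum.cong) (simp_all add: sc_resolution_J_unit(2))
    then show ?thesis using 2 i j k by (simp add: sc_resolution_J_unit(2) sum_mult_delta)
  next
    case 3
    then show ?thesis using i j k leibniz_mult11[of i j k, where 'k = 'k]
      by (auto simp: rk_resolution_J sc_resolution_J dmat_resolution_J sc_resolution_J_unit numeral_2_eq_2[symmetric])
  next
    case 4
    then show ?thesis using i j k leibniz_mult12[of i j k, where 'k = 'k]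
      by (auto simp: rk_resolution_J sc_resolution_J dmat_resolution_J sc_resolution_J_unit numeral_2_eq_2[symmetric] numeral_3_eq_3[symmetric])
  next
    case 5
    then have "(\<Sum>l<5. diff2 l i * mult11 j l k) = - (\<Sum>l<5. diff2 l i * mult11 l j k :: 'k polyA)"
      using j by (simp add: rk_resolution_J mult11_antisym[of j] flip: sum_negf)
    with 5 show ?thesis using i j k leibniz_mult12[of j i k, where 'k = 'k]
      by (auto simp: rk_resolution_J sc_resolution_J dmat_resolution_J sc_resolution_J_unit numeral_2_eq_2[symmetric] numeral_3_eq_3[symmetric])
  next
    case 6
    then show ?thesis using i j k leibniz_mult12_diff3[of i j k, where 'k = 'k]
      by (auto simp: rk_resolution_J sc_resolution_J dmat_resolution_J sc_resolution_J_unit numeral_2_eq_2[symmetric] numeral_3_eq_3[symmetric])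
  next
    case 7
    then show ?thesis using i j k leibniz_mult12_diff3[of j i k, where 'k = 'k]
      by (auto simp: rk_resolution_J sc_resolution_J dmat_resolution_J sc_resolution_J_unit numeral_2_eq_2[symmetric] numeral_3_eq_3[symmetric])
  next
    case 8
    then show ?thesis using i j k leibniz_mult12_diff2[of i j k, where 'k = 'k]
      by (auto simp: rk_resolution_J sc_resolution_J dmat_resolution_J sc_resolution_J_unit numeral_2_eq_2[symmetric] numeral_3_eq_3[symmetric])
  qed
qed

lemma homogeneous_sc_resolution_J:
  assumes "i < rk (resolution_J :: 'k polyA dgfree) p" "j < rk (resolution_J :: 'k polyA dgfree) q"
    "k < rk (resolution_J :: 'k polyA dgfree) (p + q)"
  shows "homogeneous (gdeg (resolution_J :: 'k polyA dgfree) p i + gdeg (resolution_J :: 'k polyA dgfree) q j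
    - gdeg (resolution_J :: 'k polyA dgfree) (p + q) k) (sc (resolution_J :: 'k::comm_ring_1 polyA dgfree) p q i j k)"
proof -
  have "p + q \<le> 3" using assms rk_resolution_J_pos by blast
  then consider "p = 0" | "q = 0" | "p = Suc 0" "q = Suc 0" | "p = Suc 0" "q = 2" | "p = 2" "q = Suc 0"
    by linarith
  then show ?thesis
  proof cases
    case 1
    with assms show ?thesis by (auto simp: rk_resolution_J sc_resolution_J_unit homogeneous_1) (auto simp: resolution_J_def homogeneous_1)
  next
    case 2
    with assms show ?thesis by (auto simp: sc_resolution_J_unit homogeneous_1) (auto simp: resolution_J_def homogeneous_1)
  next
    case 3
    with assms homogeneous_mult11[of i j k, where 'a = 'k] show ?thesis
      by (simp add: rk_resolution_J sc_resolution_J numeral_2_eq_2[symmetric]) (simp add: resolution_J_def)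
  next
    case 4
    with assms homogeneous_mult12[of i j k, where 'a = 'k] show ?thesis
      by (simp add: rk_resolution_J sc_resolution_J numeral_3_eq_3[symmetric]) (auto simp: resolution_J_def)
  next
    case 5
    with assms homogeneous_mult12[of j i k, where 'a = 'k] show ?thesis
      by (simp add: rk_resolution_J sc_resolution_J numeral_3_eq_3[symmetric]) (auto simp: resolution_J_def)
  qed
qed

lemma graded_dga_resolution_J: "graded_dga (resolution_J :: 'k::field polyA dgfree)"
proof (rule graded_dgaI)
  let ?F = "resolution_J :: 'k polyA dgfree"
  fix p q i j k
  assume ijk: "i < rk ?F p" "j < rk ?F q" "k < rk ?F (p + q)"
  then show "homogeneous (gdeg ?F p i + gdeg ?F q j - gdeg ?F (p + q) k) (sc ?F p q i j k)"
    by (rule homogeneous_sc_resolution_J)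
  have "p + q \<le> 3" using ijk rk_resolution_J_pos by blast
  then consider "p = 0" | "q = 0" | "p = Suc 0" "q = Suc 0" | "p = Suc 0" "q = 2" | "p = 2" "q = Suc 0"
    by linarith
  then show "sc ?F p q i j k = (- 1) ^ (p * q) * (sc ?F q p j i k :: 'k polyA)"
  proof cases
    case 3
    with ijk mult11_antisym[of i j, where 'a = 'k] show ?thesis by (simp add: rk_resolution_J sc_resolution_J)
  qed (use ijk in \<open>simp_all add: sc_resolution_J_unit sc_resolution_J\<close>)
next
  let ?F = "resolution_J :: 'k polyA dgfree"
  fix p q r i j k l
  assume ijk: "i < rk ?F p" "j < rk ?F q" "k < rk ?F r" "l < rk ?F (p + q + r)"
  have "p + q + r \<le> 3" using ijk rk_resolution_J_pos by blast
  then consider "p = 0" | "q = 0" | "r = 0" | "p = Suc 0" "q = Suc 0" "r = Suc 0"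
    by linarith
  then show "(\<Sum>m<rk ?F (p + q). sc ?F p q i j m * sc ?F (p + q) r m k l)
      = (\<Sum>m<rk ?F (q + r). sc ?F q r j k m * (sc ?F p (q + r) i m l :: 'k polyA))"
  proof cases
    case 1
    with ijk show ?thesis by (simp add: sc_resolution_J_unit(1) sum_mult_delta)
  next
    case 2
    with ijk show ?thesis by (simp add: sc_resolution_J_unit sum_mult_delta)
  next
    case 3
    with ijk show ?thesis by (simp add: sc_resolution_J_unit sum_mult_delta)
  next
    case 4
    with ijk mult11_mult12_assoc[of i j k l, where 'k = 'k] show ?thesis
      by (simp add: rk_resolution_J sc_resolution_J numeral_2_eq_2[symmetric] numeral_3_eq_3[symmetric])
  qed
qed (simp_all add: rk_resolution_J sc_resolution_J_unit leibniz_resolution_J)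

section \<open>The explicit complex is a minimal resolution\<close>

lemma boundaries_cycles_resolution_J: "boundaries resolution_J i \<subseteq> cycles (resolution_J :: 'k::comm_ring_1 polyA dgfree) i"
proof
  let ?F = "resolution_J :: 'k polyA dgfree"
  fix w assume "w \<in> boundaries ?F i"
  then obtain v where v: "v \<in> fmod ?F (Suc i)" "w = ddiff ?F (Suc i) v"
    by (auto simp: boundaries_def)
  have w: "w \<in> fmod ?F i" using ddiff_fmod[of resolution_J "Suc i" v] v(2) by simp
  have "ddiff ?F i w = zerov"
  proof (cases "v = zerov")
    case True
    with v(2) show ?thesis by simp
  next
    case False
    have "i \<le> 2"
    proof (rule ccontr)
      assume "\<not> i \<le> 2"
      then have "rk ?F (Suc i) = 0" by (intro rk_resolution_J(5)) simp
      with v(1) False show False by (auto simp: fmod_def zerov_def)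
    qed
    then consider "i = 0" | "i = Suc 0" | "i = 2" by linarith
    then have "ddiff ?F i (ddiff ?F (Suc i) (basisv k)) = (zerov :: nat \<Rightarrow> 'k polyA)"
      if k: "k < rk ?F (Suc i)" for k
    proof cases
      case 2
      have "k < 6" using k 2 by (simp add: rk_resolution_J numeral_2_eq_2[symmetric])
      have "ddiff ?F (Suc (Suc 0)) (basisv k) j = (if j < 5 then diff2 j k else (0 :: 'k polyA))" for j
        using k 2 ddiff_basisv[of k ?F 2 j]
        by (simp add: numeral_2_eq_2[symmetric] dmat_resolution_J rk_resolution_J)
      with 2 diff1_diff2[OF \<open>k < 6\<close>, where 'k = 'k] show ?thesis
        by (auto simp: ddiff_def[of ?F "Suc 0"] rk_resolution_J dmat_resolution_J zerov_def)
    next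
      case 3
      have "k < 2" using k 3 by (simp add: rk_resolution_J numeral_3_eq_3[symmetric])
      have "ddiff ?F 3 (basisv k) j = (if j < 6 then diff3 j k else (0 :: 'k polyA))" for j
        using \<open>k < 2\<close> ddiff_basisv[of k ?F 3 j]
        by (simp add: dmat_resolution_J rk_resolution_J)
      with 3 diff2_diff3[OF _ \<open>k < 2\<close>, where 'k = 'k] show ?thesis
        by (auto simp: ddiff_def[of ?F 2] rk_resolution_J dmat_resolution_J zerov_def)
    qed simp
    then have "lincomb (rk ?F (Suc i)) (\<lambda>k. ddiff ?F i (ddiff ?F (Suc i) (basisv k))) v
        = lincomb (rk ?F (Suc i)) (\<lambda>_. zerov) v" by (rule lincomb_cong)
    then show ?thesis
      by (simp add: v(2) ddiff_eq_lincomb[OF v(1)] ddiff_lincomb) (simp add: lincomb_def zerov_def)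
  qed
  with w show "w \<in> cycles ?F i" by (simp add: cycles_def)
qed

lemma acyclic_resolution_J:
  assumes "0 < i"
  shows "cycles (resolution_J :: 'k::field_char_0 polyA dgfree) i = boundaries resolution_J i"
proof (rule acyclic_if_regular3_annihilates[OF regular3_ideal_J])
  let ?F = "resolution_J :: 'k polyA dgfree"
  fix D :: "'k polyA" and i w
  assume D: "D \<in> {u134, - u123, u_disc}" and i: "0 < i" and w: "w \<in> cycles ?F i"
  obtain n where n: "n < 5" "D = diff1 n"
  proof -
    have "diff1 1 = (u134 :: 'k polyA)" "diff1 3 = (- u123 :: 'k polyA)" "diff1 4 = (u_disc :: 'k polyA)"
      by (simp_all add: diff1_def)
    with D that[of 1] that[of 3] that[of 4] show ?thesis by auto
  qed
  let ?e = "basisv n :: nat \<Rightarrow> 'k polyA"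
  have e: "?e \<in> fmod ?F 1" using n by (intro basisv_fmod) (simp add: rk_resolution_J)
  have de: "ddiff ?F 1 ?e = (\<lambda>k. D * unitv k)"
    using n by (auto simp: ddiff_basisv rk_resolution_J dmat_resolution_J unitv_def)
  have unit: "dmult ?F 0 i (ddiff ?F 1 ?e) w k = D * w k" for k
  proof -
    have "dmult ?F 0 i unitv w = w"
      using graded_dga_resolution_J[where 'k = 'k] cycles_fmod[OF w] unfolding graded_dga_def by blast
    moreover have "dmult ?F 0 i (ddiff ?F 1 ?e) w k = D * dmult ?F 0 i unitv w k"
      unfolding de by (simp add: dmult_def sum_distrib_left algebra_simps)
    ultimately show ?thesis by simp
  qed
  have "ddiff ?F (1 + i) (dmult ?F 1 i ?e w) k = D * w k" for k
  proof -
    have "ddiff ?F (1 + i) (dmult ?F 1 i ?e w) k =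
      dmult ?F (1 - 1) i (ddiff ?F 1 ?e) w k + (- 1) ^ 1 * dmult ?F 1 (i - 1) ?e (ddiff ?F i w) k"
      using graded_dga_resolution_J[where 'k = 'k] e cycles_fmod[OF w] unfolding graded_dga_def by blast
    then show ?thesis using w unit[of k] by (simp add: cycles_def)
  qed
  then have "(\<lambda>k. D * w k) = ddiff ?F (Suc i) (dmult ?F 1 i ?e w)" by auto
  moreover have "dmult ?F 1 i ?e w \<in> fmod ?F (Suc i)" using dmult_fmod[of ?F 1 i] by simp
  ultimately show "(\<lambda>k. D * w k) \<in> boundaries ?F i" unfolding boundaries_def by blast
qed (use assms boundaries_cycles_resolution_J rk_resolution_J(5) in auto)

lemma boundaries_0_resolution_J:
  "(\<lambda>v. v 0) ` boundaries (resolution_J :: 'k::comm_ring_1 polyA dgfree) 0 = ideal_J"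
proof
  interpret module "(*) :: 'k polyA \<Rightarrow> 'k polyA \<Rightarrow> 'k polyA" by (rule module_mult)
  let ?S = "{u234, u134, u124, u123, u_disc} :: 'k polyA set"
  have d: "ddiff resolution_J 1 v 0 = (\<Sum>k<5. diff1 k * (v k :: 'k polyA))" for v
    by (simp add: ddiff_def rk_resolution_J dmat_resolution_J)
  have diff1: "diff1 k \<in> span ?S" if "k < 5" for k
  proof -
    have "u234 \<in> span ?S" "u134 \<in> span ?S" "u124 \<in> span ?S" "- u123 \<in> span ?S" "u_disc \<in> span ?S"
      by (intro span_base span_neg; simp)+
    with that show ?thesis
      unfolding less_nat_cases by (elim disjE; simp add: diff1_def)
  qed
  show "(\<lambda>v. v 0) ` boundaries (resolution_J :: 'k polyA dgfree) 0 \<subseteq> ideal_J"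
  proof
    fix x assume "x \<in> (\<lambda>v. v 0) ` boundaries (resolution_J :: 'k polyA dgfree) 0"
    then obtain v where "x = (\<Sum>k<5. v k * diff1 k)"
      using d by (auto simp: boundaries_def mult.commute)
    with diff1 show "x \<in> ideal_J"
      unfolding ideal_J_def ideal_gen_def by (auto intro!: span_sum span_scale)
  qed
  show "ideal_J \<subseteq> (\<lambda>v. v 0) ` boundaries (resolution_J :: 'k polyA dgfree) 0"
    unfolding ideal_J_def ideal_gen_def
  proof (rule span_minimal)
    let ?I = "(\<lambda>v. v 0) ` boundaries (resolution_J :: 'k polyA dgfree) 0"
    have I: "ddiff resolution_J 1 v 0 \<in> ?I" if "v \<in> fmod resolution_J 1" for v
      using that by (auto simp: boundaries_def)
    have scale: "c * x \<in> ?I" if x: "x \<in> ?I" for c x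
    proof -
      obtain v where "v \<in> fmod resolution_J 1" "x = ddiff resolution_J 1 v 0" using x by (auto simp: boundaries_def)
      with I[OF fmod_scale[of v resolution_J 1 c]] show ?thesis by (simp add: ddiff_scale)
    qed
    have add: "x + y \<in> ?I" if x: "x \<in> ?I" "y \<in> ?I" for x y
    proof -
      obtain v w where "v \<in> fmod resolution_J 1" "x = ddiff resolution_J 1 v 0" "w \<in> fmod resolution_J 1" "y = ddiff resolution_J 1 w 0"
        using x by (auto simp: boundaries_def)
      with I[OF fmod_add[of v resolution_J 1 w]] show ?thesis by (simp add: ddiff_add)
    qed
    have gen: "diff1 k \<in> ?I" if "k < 5" for k
      using that I[OF basisv_fmod[of k resolution_J 1]] by (simp add: ddiff_basisv rk_resolution_J dmat_resolution_J)
    have "0 \<in> ?I" using I[of zerov] by simp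
    with scale add show "subspace ?I" by (simp add: subspace_def)
    have "u123 \<in> ?I" using scale[OF gen[of 3], of "- 1"] by (simp add: diff1_def)
    moreover have "u234 \<in> ?I" "u134 \<in> ?I" "u124 \<in> ?I" "u_disc \<in> ?I"
      using gen[of 0] gen[of 1] gen[of 2] gen[of 4] by (simp_all add: diff1_def)
    ultimately show "?S \<subseteq> ?I" by blast
  qed
qed

text \<open>The strict increase of internal degrees makes every matrix entry of positive degree,
  which yields minimality.\<close>

lemma homogeneous_dmat_resolution_J:
  assumes "0 < i" "j < rk resolution_J (i - 1)" "k < rk resolution_J i"
  shows "homogeneous (gdeg resolution_J i k - gdeg resolution_J (i - 1) j) (dmat (resolution_J :: 'k::comm_ring_1 polyA dgfree) i j k)"
    and "gdeg (resolution_J :: 'k polyA dgfree) (i - 1) j < gdeg (resolution_J :: 'k polyA dgfree) i k"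
proof -
  have "i \<le> 3" using assms(3) by (rule rk_resolution_J_pos)
  with assms(1) have i: "i = Suc 0 \<or> i = 2 \<or> i = 3" by (rule positive_nat_le_3_cases)
  with assms show "homogeneous (gdeg resolution_J i k - gdeg resolution_J (i - 1) j) (dmat (resolution_J :: 'k polyA dgfree) i j k)"
    using homogeneous_diff1[of k, where 'a = 'k] homogeneous_diff2[of j k, where 'a = 'k] homogeneous_diff3[of j k, where 'a = 'k]
    by (elim disjE; cases "j < 4"; simp add: rk_resolution_J dmat_resolution_J gdeg_resolution_J)
  from i assms show "gdeg (resolution_J :: 'k polyA dgfree) (i - 1) j < gdeg (resolution_J :: 'k polyA dgfree) i k"
    by (auto simp: gdeg_resolution_J)
qed

lemma min_dga_resolution_resolution_J: "min_dga_resolution (resolution_J :: 'k::field_char_0 polyA dgfree) ideal_J"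
  unfolding min_dga_resolution_def
proof (intro conjI allI impI)
  show "graded_free_resolution (resolution_J :: 'k polyA dgfree) ideal_J"
    unfolding graded_free_resolution_def
    using homogeneous_dmat_resolution_J(1)[where 'k = 'k] acyclic_resolution_J[where 'k = 'k] boundaries_0_resolution_J[where 'k = 'k]
    by (simp add: rk_resolution_J) (simp add: resolution_J_def)
  show "minimal_complex (resolution_J :: 'k polyA dgfree)"
    unfolding minimal_complex_def
  proof (intro allI impI)
    fix i j k assume "0 < i" "j < rk (resolution_J :: 'k polyA dgfree) (i - 1)" "k < rk (resolution_J :: 'k polyA dgfree) i"
    note h = homogeneous_dmat_resolution_J[OF this]
    have "const_coeff (dmat (resolution_J :: 'k polyA dgfree) i j k) = 0"
      by (rule const_coeff_if_positive_degree, rule positive_degree_if_homogeneous[OF h(1)]) (use h(2) in simp)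
    then show "dmat (resolution_J :: 'k polyA dgfree) i j k \<in> irrelevant_ideal"
      using kernel_const_coeff by blast
  qed
qed (simp_all add: rk_resolution_J graded_dga_resolution_J)

section \<open>Triviality of the multiplication\<close>

lemma Tor_mult_zero:
  assumes sc: "\<And>i j k. i < rk F p \<Longrightarrow> j < rk F q \<Longrightarrow> k < rk F (p + q) \<Longrightarrow> positive_degree (sc F p q i j k)"
    and X: "X \<in> Tor F p" and Y: "Y \<in> Tor F q"
  shows "Tor_mult F p q X Y = Tor_zero F (p + q)"
proof -
  \<comment> \<open>\<open>hmult\<close> is a union over representatives, so an empty class would
    give the empty set instead of the zero class.\<close>
  have nonempty: "W \<noteq> {}" if W: "W \<in> Tor F i" for W i
  proof -
    obtain v where v: "W = hclass (tensor_K F) i v" using W by (auto simp: Tor_def homology_def)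
    have "zerov \<in> boundaries (tensor_K F) i"
      unfolding boundaries_def by (rule image_eqI[of _ _ zerov]) simp_all
    then have "v \<in> W" by (simp add: v hclass_def zerov_def)
    then show ?thesis by blast
  qed
  have "dmult (tensor_K F) p q v w = zerov" for v w
    using sc by (auto simp: dmult_def base_change_def zerov_def const_coeff_if_positive_degree intro!: sum.neutral)
  then show ?thesis
    using nonempty[OF X] nonempty[OF Y] by (auto simp: Tor_mult_def hmult_def Tor_zero_def)
qed

theorem mainTheorem4:
  shows "(\<exists>F :: 'k::field_char_0 polyA dgfree. min_dga_resolution F ideal_J) \<and>
    (\<forall>F :: 'k polyA dgfree. min_dga_resolution F ideal_J \<longrightarrow>
       (\<forall>i<rk F 1. \<forall>j<rk F 1. \<forall>k<rk F 2. positive_degree (sc F 1 1 i j k)) \<and>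
       (\<forall>i<rk F 1. \<forall>j<rk F 2. \<forall>k<rk F 3. positive_degree (sc F 1 2 i j k)) \<and>
       (\<forall>X\<in>Tor F 1. \<forall>Y\<in>Tor F 1. Tor_mult F 1 1 X Y = Tor_zero F 2) \<and>
       (\<forall>X\<in>Tor F 1. \<forall>Y\<in>Tor F 2. Tor_mult F 1 2 X Y = Tor_zero F 3))"
proof (intro conjI allI impI)
  show "\<exists>F :: 'k polyA dgfree. min_dga_resolution F ideal_J"
    using min_dga_resolution_resolution_J by blast
  fix F :: "'k polyA dgfree"
  assume F: "min_dga_resolution F ideal_J"
  have "\<exists>l<rk (resolution_J :: 'k polyA dgfree) p. gdeg F p k = gdeg (resolution_J :: 'k polyA dgfree) p l"
    if "k < rk F p" for p k
    using F min_dga_resolution_resolution_J[where 'k = 'k] that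
    by (intro minimal_resolution_gdeg) (auto simp: min_dga_resolution_def)
  then have deg: "k < rk F 1 \<Longrightarrow> 3 \<le> gdeg F 1 k" "k < rk F 2 \<Longrightarrow> gdeg F 2 k = 5"
    "k < rk F 3 \<Longrightarrow> gdeg F 3 k = 7" for k
    by (fastforce simp: resolution_J_def)+
  have hom: "homogeneous (gdeg F p i + gdeg F q j - gdeg F (p + q) k) (sc F p q i j k)"
    if "i < rk F p" "j < rk F q" "k < rk F (p + q)" for p q i j k
    using F that by (simp add: min_dga_resolution_def graded_dga_def)
  have pos11: "positive_degree (sc F 1 1 i j k)" if "i < rk F 1" "j < rk F 1" "k < rk F 2" for i j k
    by (rule positive_degree_if_homogeneous[OF hom[of i 1 j 1 k]])
      (use deg(1)[of i] deg(1)[of j] deg(2)[of k] that in \<open>simp_all add: numeral_2_eq_2\<close>)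
  have pos12: "positive_degree (sc F 1 2 i j k)" if "i < rk F 1" "j < rk F 2" "k < rk F 3" for i j k
    by (rule positive_degree_if_homogeneous[OF hom[of i 1 j 2 k]])
      (use deg(1)[of i] deg(2)[of j] deg(3)[of k] that in \<open>simp_all add: numeral_3_eq_3\<close>)
  show "positive_degree (sc F 1 1 i j k)" if "i < rk F 1" "j < rk F 1" "k < rk F 2" for i j k
    using that by (rule pos11)
  show "positive_degree (sc F 1 2 i j k)" if "i < rk F 1" "j < rk F 2" "k < rk F 3" for i j k
    using that by (rule pos12)
  show "\<forall>X\<in>Tor F 1. \<forall>Y\<in>Tor F 1. Tor_mult F 1 1 X Y = Tor_zero F 2"
    using Tor_mult_zero[of F 1 1] pos11 by (simp add: numeral_2_eq_2)
  show "\<forall>X\<in>Tor F 1. \<forall>Y\<in>Tor F 2. Tor_mult F 1 2 X Y = Tor_zero F 3"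
    using Tor_mult_zero[of F 1 2] pos12 by (simp add: numeral_3_eq_3)
qed

end
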